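(* Let $G$ be a finitely generated group, let $N$ be a nilpotent group with a closed subgroup $\Gamma$, and let $\varphi:G\to N$ be polynomial. Then for every $x\in N$ such that $\varphi(G)\not\subset x\Gamma$ the set $\varphi^{-1}(x\Gamma)$ is negligible by finite quotients of $G$.
   Context: A subgroup $\Gamma$ of a group $N$ is closed in $N$ if for every $x\in N$ and every non-zero integer $n$ we have $x^n\in\Gamma$ if and only if $x\in\Gamma$ (no topology is involved). Let $G,H$ be groups and $\varphi:G\to H$ a map. For $u\in G$, the $u$-derivative $\partial_u\varphi:G\to H$ is defined by $\partial_u\varphi(x)=\varphi(x)^{-1}\varphi(xu)$. For an integer $d\ge0$, $\varphi$ is polynomial of degree $d$ if $\partial_{u_1}\cdots\partial_{u_{d+1}}\varphi\equiv1$ for all $u_1,\ldots,u_{d+1}\in G$; $\varphi$ is polynomial if it is polynomial of degree $d$ for some $d$. A subset $V$ of $G$ is negligible by finite quotients of $G$ if for every $\varepsilon>0$ there exists a finite-index normal subgroup $K\lhd G$ such that $|VK/K|\le\varepsilon|G/K|$, where $VK/K$ denotes the image of $V$ in $G/K$. *)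

theory Defs
  imports Complex_Main "HOL-Algebra.Generated_Groups"
begin

definition finitely_generated_group :: "('a, 'b) monoid_scheme \<Rightarrow> bool" where
  "finitely_generated_group G \<longleftrightarrow>
     group G \<and> (\<exists>S. finite S \<and> S \<subseteq> carrier G \<and> generate G S = carrier G)"

primrec lower_central :: "('a, 'b) monoid_scheme \<Rightarrow> nat \<Rightarrow> 'a set" where
  "lower_central G 0 = carrier G"
| "lower_central G (Suc k) = generate G
     {a \<otimes>\<^bsub>G\<^esub> b \<otimes>\<^bsub>G\<^esub> inv\<^bsub>G\<^esub> a \<otimes>\<^bsub>G\<^esub> inv\<^bsub>G\<^esub> b | a b.
        a \<in> lower_central G k \<and> b \<in> carrier G}"

definition nilpotent_group :: "('a, 'b) monoid_scheme \<Rightarrow> bool" where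
  "nilpotent_group G \<longleftrightarrow> group G \<and> (\<exists>c. lower_central G c = {\<one>\<^bsub>G\<^esub>})"

(* Closed under taking powers and roots; no topology is involved. *)
definition closed_subgroup :: "'a set \<Rightarrow> ('a, 'b) monoid_scheme \<Rightarrow> bool" where
  "closed_subgroup \<Gamma> N \<longleftrightarrow> subgroup \<Gamma> N \<and>
     (\<forall>x\<in>carrier N. \<forall>n::int. n \<noteq> 0 \<longrightarrow> (x [^]\<^bsub>N\<^esub> n \<in> \<Gamma> \<longleftrightarrow> x \<in> \<Gamma>))"

definition group_derivative ::
    "('a, 'b) monoid_scheme \<Rightarrow> ('c, 'd) monoid_scheme \<Rightarrow> 'a \<Rightarrow> ('a \<Rightarrow> 'c) \<Rightarrow> 'a \<Rightarrow> 'c" where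
  "group_derivative G H u \<phi> = (\<lambda>x. inv\<^bsub>H\<^esub> (\<phi> x) \<otimes>\<^bsub>H\<^esub> \<phi> (x \<otimes>\<^bsub>G\<^esub> u))"

(* The foldr over [u1, ..., um] is the iterated derivative in which um is applied first. *)
definition polynomial_of_degree ::
    "('a, 'b) monoid_scheme \<Rightarrow> ('c, 'd) monoid_scheme \<Rightarrow> nat \<Rightarrow> ('a \<Rightarrow> 'c) \<Rightarrow> bool" where
  "polynomial_of_degree G H d \<phi> \<longleftrightarrow> \<phi> \<in> carrier G \<rightarrow> carrier H \<and>
     (\<forall>us. set us \<subseteq> carrier G \<and> length us = d + 1 \<longrightarrow>
        (\<forall>x\<in>carrier G. foldr (group_derivative G H) us \<phi> x = \<one>\<^bsub>H\<^esub>))"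

definition polynomial_map ::
    "('a, 'b) monoid_scheme \<Rightarrow> ('c, 'd) monoid_scheme \<Rightarrow> ('a \<Rightarrow> 'c) \<Rightarrow> bool" where
  "polynomial_map G H \<phi> \<longleftrightarrow> (\<exists>d. polynomial_of_degree G H d \<phi>)"

(* Finiteness of G Mod K is required explicitly because card is 0 on infinite sets.
   The image of V in G Mod K is a set of right cosets, as in the library's quotient. *)
definition negligible_by_finite_quotients :: "('a, 'b) monoid_scheme \<Rightarrow> 'a set \<Rightarrow> bool" where
  "negligible_by_finite_quotients G V \<longleftrightarrow> V \<subseteq> carrier G \<and>
     (\<forall>\<epsilon>::real. \<epsilon> > 0 \<longrightarrow>
        (\<exists>K. K \<lhd> G \<and> finite (carrier (G Mod K)) \<and>
           real (card ((\<lambda>g. K #>\<^bsub>G\<^esub> g) ` V)) \<le> \<epsilon> * real (card (carrier (G Mod K)))))"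

end

theory Submission
  imports Defs "HOL-Algebra.Zassenhaus" "HOL-Computational_Algebra.Polynomial"
    "HOL-Computational_Algebra.Primes"
begin

text \<open>
  Translate so that \<open>x = \<one>\<close> and let \<open>M\<close> be the subgroup generated by the values of \<open>\<phi>\<close>. In a
  nilpotent group, a subgroup that contains a positive power of every element modulo commutators
  contains a positive power of every element. As \<open>\<Gamma> \<inter> M\<close> is closed and proper in \<open>M\<close>, the quotient of \<open>M\<close> by
  \<open>(\<Gamma> \<inter> M) [M, M]\<close> is therefore not torsion, and some nonzero homomorphism from \<open>M\<close> to the rationals
  kills \<open>\<Gamma> \<inter> M\<close>. Composing it with \<open>\<phi>\<close> and clearing denominators, which are bounded because \<open>G\<close> is
  finitely generated, gives a nonzero integer-valued polynomial \<open>F\<close> on \<open>G\<close> that vanishes on the set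
  in question. Modulo a large prime \<open>p\<close>, there are only finitely many polynomials of bounded degree,
  so \<open>F\<close> mod \<open>p\<close> factors through a finite quotient of \<open>G\<close>, where its zeros have density at most
  \<open>n\<^sup>2 / p\<close> by a Schwartz--Zippel count along cosets of cyclic subgroups.
\<close>

section \<open>Powers in subgroups of nilpotent groups\<close>

context group begin

abbreviation commutator where
  "commutator a b \<equiv> a \<otimes> b \<otimes> inv a \<otimes> inv b"

lemma inv_mult_cancel:
  assumes "a \<in> carrier G" "b \<in> carrier G"
  shows "inv a \<otimes> (a \<otimes> b) = b" "a \<otimes> (inv a \<otimes> b) = b"
  using assms by (simp_all add: m_assoc[symmetric])

lemma commutator_eqD:
  assumes "a \<in> carrier G" "b \<in> carrier G"
  shows "commutator a b \<otimes> b \<otimes> a = a \<otimes> b"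
  using assms by (simp add: m_assoc)

lemma commutator_eqI:
  assumes "a \<in> carrier G" "b \<in> carrier G" "c \<in> carrier G" "a \<otimes> b = c \<otimes> b \<otimes> a"
  shows "commutator a b = c"
  using assms by (simp add: m_assoc)

text \<open>A conjugate of a commutator is the commutator of the conjugates, so by induction the
  generating set is stable under conjugation.\<close>

lemma lower_central_normal: "lower_central G i \<lhd> G"
proof (induction i)
  case 0
  show ?case by (simp add: normal_self)
next
  case (Suc i)
  interpret normal "lower_central G i" G by (fact Suc)
  let ?S = "{commutator a b | a b. a \<in> lower_central G i \<and> b \<in> carrier G}"
  have "g \<otimes> h \<otimes> inv g \<in> ?S" if h: "h \<in> ?S" and g: "g \<in> carrier G" for g h
  proof -
    from h obtain a b where ab: "a \<in> lower_central G i" "b \<in> carrier G" "h = commutator a b"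
      by blast
    then have a: "a \<in> carrier G" by (simp add: subset[THEN subsetD])
    let ?a = "g \<otimes> a \<otimes> inv g" and ?b = "g \<otimes> b \<otimes> inv g"
    have "g \<otimes> h \<otimes> inv g = commutator ?a ?b"
      using ab a g by (simp add: m_assoc inv_mult_group inv_mult_cancel)
    moreover have "?a \<in> lower_central G i" using ab(1) g by (rule inv_op_closed2[rotated])
    ultimately show ?thesis using ab g by blast
  qed
  moreover have "?S \<subseteq> carrier G" using subset by auto
  ultimately show ?case
    unfolding lower_central.simps by (intro normal_generateI)
qed

lemma lower_central_subgroup: "subgroup (lower_central G i) G"
  by (rule normal_imp_subgroup[OF lower_central_normal])

lemma commutator_in_lower_central:
  assumes "a \<in> lower_central G i" "b \<in> carrier G"
  shows "commutator a b \<in> lower_central G (Suc i)"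
  using assms by (auto intro: generate.incl)

text \<open>By normality \<open>b \<otimes> inv a \<otimes> inv b\<close> stays in the term that
  contains \<open>a\<close>, and hence so does the commutator.\<close>

lemma lower_central_Suc_subset: "lower_central G (Suc i) \<subseteq> lower_central G i"
proof -
  interpret normal "lower_central G i" G by (fact lower_central_normal)
  have "commutator a b \<in> lower_central G i" if "a \<in> lower_central G i" "b \<in> carrier G" for a b
  proof -
    have "a \<otimes> (b \<otimes> inv a \<otimes> inv b) \<in> lower_central G i"
      using that by (intro m_closed inv_op_closed2 m_inv_closed)
    then show ?thesis using that subset by (auto simp: m_assoc)
  qed
  then show ?thesis
    unfolding lower_central.simps
    by (intro generate_subgroup_incl[OF _ lower_central_subgroup]) blast
qed

text \<open>Inverses and generated subgroups are the same in \<open>M\<close> and in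
  \<open>G\<close>, so by induction each generator of the series of \<open>M\<close> is one of the
  generators for \<open>G\<close>.\<close>

lemma lower_central_subgroup_mono:
  assumes "subgroup M G"
  shows "lower_central (G\<lparr>carrier := M\<rparr>) i \<subseteq> lower_central G i"
proof (induction i)
  case 0
  show ?case using subgroup.subset[OF assms] by simp
next
  case (Suc i)
  interpret M: group "G\<lparr>carrier := M\<rparr>" using assms by (rule subgroup_imp_group)
  let ?S = "{a \<otimes> b \<otimes> inv\<^bsub>G\<lparr>carrier := M\<rparr>\<^esub> a \<otimes> inv\<^bsub>G\<lparr>carrier := M\<rparr>\<^esub> b | a b.
      a \<in> lower_central (G\<lparr>carrier := M\<rparr>) i \<and> b \<in> M}"
  let ?T = "{commutator a b | a b. a \<in> lower_central G i \<and> b \<in> carrier G}"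
  have low: "lower_central (G\<lparr>carrier := M\<rparr>) i \<subseteq> M"
    using subgroup.subset[OF M.lower_central_subgroup] by simp
  have inv: "inv\<^bsub>G\<lparr>carrier := M\<rparr>\<^esub> a = inv a" if "a \<in> M" for a
    using m_inv_consistent[OF assms that] .
  have S: "s \<in> M \<and> s \<in> ?T" if s: "s \<in> ?S" for s
  proof -
    obtain a b where ab: "a \<in> lower_central (G\<lparr>carrier := M\<rparr>) i" "b \<in> M"
      and "s = a \<otimes> b \<otimes> inv\<^bsub>G\<lparr>carrier := M\<rparr>\<^esub> a \<otimes> inv\<^bsub>G\<lparr>carrier := M\<rparr>\<^esub> b"
      using s by blast
    then have s: "s = commutator a b" using inv low by auto
    have "s \<in> M" using ab low unfolding s
      by (auto intro!: subgroup.m_closed[OF assms] subgroup.m_inv_closed[OF assms])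
    then show ?thesis using ab Suc subgroup.subset[OF assms] s by blast
  qed
  then have "?S \<subseteq> M" by blast
  then have "generate (G\<lparr>carrier := M\<rparr>) ?S = generate G ?S"
    using generate_consistent assms by blast
  moreover have "?S \<subseteq> ?T" using S by blast
  ultimately show ?case using mono_generate[of ?S ?T] by simp
qed

lemma nilpotent_subgroup:
  assumes "nilpotent_group G" "subgroup M G"
  shows "nilpotent_group (G\<lparr>carrier := M\<rparr>)"
proof -
  interpret M: group "G\<lparr>carrier := M\<rparr>" using assms(2) by (rule subgroup_imp_group)
  obtain c where "lower_central G c = {\<one>}"
    using assms(1) by (auto simp: nilpotent_group_def)
  with lower_central_subgroup_mono[OF assms(2), of c] subgroup.one_closed[OF M.lower_central_subgroup, of c]
  have "lower_central (G\<lparr>carrier := M\<rparr>) c = {\<one>\<^bsub>G\<lparr>carrier := M\<rparr>\<^esub>}" by auto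
  then show ?thesis unfolding nilpotent_group_def using M.is_group by blast
qed

section \<open>Central commutators\<close>

lemma commute_pow_central:
  assumes "a \<in> carrier G" "b \<in> carrier G" "c \<in> carrier G"
    and central: "\<And>g. g \<in> carrier G \<Longrightarrow> c \<otimes> g = g \<otimes> c"
    and "a \<otimes> b = c \<otimes> b \<otimes> a"
  shows "a [^] (k::nat) \<otimes> b = c [^] k \<otimes> b \<otimes> a [^] k"
proof (induction k)
  case 0
  show ?case using assms by simp
next
  case (Suc k)
  have "a [^] Suc k \<otimes> b = a [^] k \<otimes> (a \<otimes> b)" using assms by (simp add: m_assoc)
  also have "\<dots> = a [^] k \<otimes> (c \<otimes> (b \<otimes> a))" using assms by (simp add: m_assoc)
  also have "\<dots> = c \<otimes> (a [^] k \<otimes> b) \<otimes> a"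
    using assms(1-3) central[of "a [^] k"] by (simp add: m_assoc[symmetric])
  also have "\<dots> = c [^] Suc k \<otimes> b \<otimes> a [^] Suc k"
    unfolding Suc using assms(1-3) central[of "c [^] k"] by (simp add: m_assoc[symmetric])
  finally show ?case .
qed

text \<open>Moving one \<open>a\<close> past one \<open>b\<close> costs one central factor.
  \<open>commute_pow_central\<close> counts these factors first for powers of \<open>a\<close>,
  then, with the roles exchanged and \<open>inv (c [^] k)\<close> as the cost, for powers of
  \<open>b\<close>.\<close>

lemma commutator_pow_central:
  assumes ab: "a \<in> carrier G" "b \<in> carrier G"
    and central: "\<And>g. g \<in> carrier G \<Longrightarrow> commutator a b \<otimes> g = g \<otimes> commutator a b"
  shows "commutator (a [^] (k::nat)) (b [^] (l::nat)) = commutator a b [^] (k * l)"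
proof -
  define c where "c = commutator a b"
  have c: "c \<in> carrier G" using ab by (simp add: c_def)
  have cpow: "c [^] (m::nat) \<otimes> g = g \<otimes> c [^] m" if "g \<in> carrier G" for g m
    using that c central[folded c_def] by (metis group_commutes_pow)
  have "a \<otimes> b = c \<otimes> b \<otimes> a" using ab commutator_eqD c_def by simp
  then have 1: "a [^] k \<otimes> b = c [^] k \<otimes> b \<otimes> a [^] k"
    using commute_pow_central ab c central[folded c_def] by blast
  define d where "d = inv (c [^] k)"
  have d: "d \<in> carrier G" using c by (simp add: d_def)
  have 2: "b \<otimes> a [^] k = d \<otimes> a [^] k \<otimes> b"
    using ab c 1 by (simp add: d_def m_assoc inv_solve_left)
  have dc: "d \<otimes> g = g \<otimes> d" if "g \<in> carrier G" for g
    using cpow[OF that, of k] that c unfolding d_def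
    by (metis inv_closed inv_mult_cancel(1) inv_solve_right m_assoc m_closed nat_pow_closed)
  have 3: "b [^] l \<otimes> a [^] k = d [^] l \<otimes> a [^] k \<otimes> b [^] l"
    using commute_pow_central[of b "a [^] k" d l] ab d dc 2 by simp
  have "a [^] k \<otimes> b [^] l = c [^] (k * l) \<otimes> b [^] l \<otimes> a [^] k"
  proof -
    have "d [^] l = inv (c [^] (k * l))"
      using c by (simp add: d_def nat_pow_inv nat_pow_pow)
    with 3 show ?thesis using ab c by (simp add: m_assoc inv_solve_left)
  qed
  then show ?thesis
    using commutator_eqI ab c by (simp add: c_def)
qed

text \<open>Central factors cancel in a commutator. This turns commutators of elements of
  \<open>H <#> Z\<close> into commutators of elements of \<open>H\<close>.\<close>

lemma commutator_mult_central:
  assumes "h \<in> carrier G" "h' \<in> carrier G" "z \<in> carrier G" "z' \<in> carrier G"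
    and "\<And>g. g \<in> carrier G \<Longrightarrow> z \<otimes> g = g \<otimes> z"
    and "\<And>g. g \<in> carrier G \<Longrightarrow> z' \<otimes> g = g \<otimes> z'"
  shows "commutator (h \<otimes> z) (h' \<otimes> z') = commutator h h'"
proof (rule commutator_eqI)
  have "h \<otimes> z \<otimes> (h' \<otimes> z') = h \<otimes> h' \<otimes> (z \<otimes> z')"
    using assms(1-4) assms(5)[of h'] by (metis m_assoc m_closed)
  also have "h \<otimes> h' = commutator h h' \<otimes> h' \<otimes> h"
    using commutator_eqD assms by simp
  also have "commutator h h' \<otimes> h' \<otimes> h \<otimes> (z \<otimes> z') = commutator h h' \<otimes> (h' \<otimes> z') \<otimes> (h \<otimes> z)"
  proof -
    have "h \<otimes> (z \<otimes> z') = z' \<otimes> (h \<otimes> z)"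
      using assms(1-4) assms(6)[of "h \<otimes> z"] by (simp add: m_assoc)
    then have "commutator h h' \<otimes> h' \<otimes> (h \<otimes> (z \<otimes> z')) = commutator h h' \<otimes> h' \<otimes> (z' \<otimes> (h \<otimes> z))"
      by simp
    then show ?thesis using assms(1-4) m_assoc by (metis inv_closed m_closed)
  qed
  finally show "h \<otimes> z \<otimes> (h' \<otimes> z') = commutator h h' \<otimes> (h' \<otimes> z') \<otimes> (h \<otimes> z)" .
qed (use assms in simp_all)

text \<open>If \<open>Z\<close> is central, \<open>[a, b]\<^sup>k\<^sup>l = [a\<^sup>k, b\<^sup>l]\<close>, and modulo \<open>Z\<close> the powers \<open>a\<^sup>k\<close> and
  \<open>b\<^sup>l\<close> lie in \<open>H\<close>; so each generator of \<open>Z\<close> has a power in \<open>H\<close>.\<close>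
lemma power_in_subgroup_of_central:
  assumes H: "subgroup H G" and A: "A \<subseteq> carrier G"
    and Z: "Z = generate G {commutator a b | a b. a \<in> A \<and> b \<in> carrier G}"
    and central: "\<And>z g. z \<in> Z \<Longrightarrow> g \<in> carrier G \<Longrightarrow> z \<otimes> g = g \<otimes> z"
    and pow: "\<And>y. y \<in> carrier G \<Longrightarrow> \<exists>k>0. y [^] (k::nat) \<in> H <#> Z"
    and y: "y \<in> carrier G"
  shows "\<exists>k>0. y [^] (k::nat) \<in> H"
proof -
  interpret H: subgroup H G by fact
  have Hpow: "h [^] (m::nat) \<in> H" if "h \<in> H" for h m
    using that by (induction m) auto
  have Zsub: "Z \<subseteq> carrier G" unfolding Z using A by (intro generate_incl) auto
  have zpow: "\<exists>k>0. z [^] (k::nat) \<in> H" if "z \<in> Z" for z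
  proof -
    have comm: "\<exists>k>0. commutator a b [^] (k::nat) \<in> H" if a: "a \<in> A" and b: "b \<in> carrier G" for a b
    proof -
      obtain k h z where k: "k > 0" "h \<in> H" "z \<in> Z" "a [^] (k::nat) = h \<otimes> z"
        using pow[of a] a A by (auto simp: set_mult_def)
      obtain l h' z' where l: "l > 0" "h' \<in> H" "z' \<in> Z" "b [^] (l::nat) = h' \<otimes> z'"
        using pow[of b] b by (auto simp: set_mult_def)
      have "commutator a b \<in> Z" unfolding Z using a b by (blast intro: generate.incl)
      then have "commutator a b [^] (k * l) = commutator (a [^] k) (b [^] l)"
        using a b A central by (intro commutator_pow_central[symmetric]) auto
      also have "\<dots> = commutator h h'"
        unfolding k(4) l(4) using k(2,3) l(2,3) Zsub central by (intro commutator_mult_central) auto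
      also have "\<dots> \<in> H" using k l by simp
      finally show ?thesis using k l by (intro exI[of _ "k * l"]) simp
    qed
    from that[unfolded Z] show ?thesis
    proof induction
      case one
      show ?case by (rule exI[of _ 1]) simp
    next
      case (incl h)
      then show ?case using comm by blast
    next
      case (inv h)
      then obtain k where k: "k > 0" "h [^] (k::nat) \<in> H" using comm by blast
      moreover have "h \<in> carrier G" using inv A by auto
      ultimately show ?case using nat_pow_inv H.m_inv_closed by metis
    next
      case (eng h1 h2)
      then obtain k l where k: "k > 0" "h1 [^] (k::nat) \<in> H" and l: "l > 0" "h2 [^] (l::nat) \<in> H"
        by blast
      have c: "h1 \<in> carrier G" "h2 \<in> carrier G" using eng.hyps Zsub Z by auto
      \<comment> \<open>\<open>h1\<close> and \<open>h2\<close> lie in the central \<open>Z\<close>,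
        so the power splits, and \<open>k * l\<close> is a multiple of both exponents.\<close>
      have "(h1 \<otimes> h2) [^] (k * l) = (h1 [^] k) [^] l \<otimes> (h2 [^] l) [^] k"
        using pow_mult_distrib[of h1 h2 "k * l"] c central[of h1 h2] eng.hyps Z
        by (simp add: nat_pow_pow mult.commute)
      also have "\<dots> \<in> H" using k l by (simp add: Hpow)
      finally show ?case using k l by (intro exI[of _ "k * l"]) simp
    qed
  qed
  obtain k h z where k: "k > 0" "h \<in> H" "z \<in> Z" "y [^] (k::nat) = h \<otimes> z"
    using pow[of y] y by (auto simp: set_mult_def)
  obtain l where l: "l > 0" "z [^] (l::nat) \<in> H" using zpow k by blast
  have "y [^] (k * l) = (h \<otimes> z) [^] l" using y k by (simp add: nat_pow_pow[symmetric])
  also have "\<dots> = h [^] l \<otimes> z [^] l"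
    using pow_mult_distrib[of h z l] central[of z h] k Zsub by (auto simp: subset_iff)
  also have "\<dots> \<in> H" using k l by (simp add: Hpow)
  finally show ?thesis using k l by (intro exI[of _ "k * l"]) simp
qed

end

section \<open>Passage to quotients by the lower central series\<close>

lemma (in group_hom) img_set_mult:
  assumes "A \<subseteq> carrier G" "B \<subseteq> carrier G"
  shows "h ` (A <#> B) = h ` A <#>\<^bsub>H\<^esub> h ` B"
proof -
  have "h (a \<otimes> b) = h a \<otimes>\<^bsub>H\<^esub> h b" if "a \<in> A" "b \<in> B" for a b
    using that assms by (intro hom_mult) auto
  then show ?thesis
    unfolding set_mult_def image_UN by simp
qed

text \<open>Homomorphisms map commutators to commutators; surjectivity makes the second entry of the
  image commutators range over all of \<open>H\<close>.\<close>

lemma (in group_hom) lower_central_img: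
  assumes "h ` carrier G = carrier H"
  shows "h ` lower_central G i = lower_central H i"
proof (induction i)
  case 0
  show ?case using assms by simp
next
  case (Suc i)
  have sub: "lower_central G i \<subseteq> carrier G"
    using G.lower_central_subgroup subgroup.subset by blast
  let ?S = "{G.commutator a b | a b. a \<in> lower_central G i \<and> b \<in> carrier G}"
  have comm: "h (G.commutator a b) = H.commutator (h a) (h b)"
    if "a \<in> carrier G" "b \<in> carrier G" for a b
    using that by simp
  have "h ` ?S = {H.commutator (h a) (h b) | a b. a \<in> lower_central G i \<and> b \<in> carrier G}"
  proof (intro equalityI subsetI)
    fix y assume "y \<in> h ` ?S"
    then obtain a b where "a \<in> lower_central G i" "b \<in> carrier G" "y = h (G.commutator a b)" by blast
    then show "y \<in> {H.commutator (h a) (h b) | a b. a \<in> lower_central G i \<and> b \<in> carrier G}"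
      using comm sub by blast
  next
    fix y assume "y \<in> {H.commutator (h a) (h b) | a b. a \<in> lower_central G i \<and> b \<in> carrier G}"
    then obtain a b where ab: "a \<in> lower_central G i" "b \<in> carrier G" "y = H.commutator (h a) (h b)" by blast
    then have "y = h (G.commutator a b)" using comm sub by (simp only: subset_iff)
    then show "y \<in> h ` ?S" using ab by blast
  qed
  also have "\<dots> = {H.commutator a b | a b. a \<in> lower_central H i \<and> b \<in> carrier H}"
    unfolding Suc[symmetric] assms[symmetric] by blast
  finally have "h ` ?S = \<dots>" .
  moreover have "h ` generate G ?S = generate H (h ` ?S)"
    using sub by (intro generate_img[symmetric]) auto
  ultimately show ?case by simp
qed

context group begin

text \<open>Descent along the lower central series, starting from the commutator subgroup, which has
  index \<open>Suc 0\<close>. Modulo the next term the current one is central, so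
  \<open>power_in_subgroup_of_central\<close> removes it; nilpotency ends the descent.\<close>

lemma power_in_subgroup_of_nilpotent:
  assumes nil: "nilpotent_group G" and H: "subgroup H G"
    and pow: "\<And>y. y \<in> carrier G \<Longrightarrow> \<exists>k>0. y [^] (k::nat) \<in> H <#> lower_central G (Suc 0)"
    and y: "y \<in> carrier G"
  shows "\<exists>k>0. y [^] (k::nat) \<in> H"
proof -
  have step: "\<exists>k>0. y [^] (k::nat) \<in> H <#> lower_central G (Suc i)" if "y \<in> carrier G" for i y
    using that
  proof (induction i arbitrary: y)
    case 0
    then show ?case by (rule pow)
  next
    case (Suc i)
    \<comment> \<open>In \<open>G Mod L\<close> the image of \<open>Z\<close> is central, and a
      power of \<open>y\<close> in the image of \<open>H\<close> there is a power in
      \<open>H <#> L\<close> here.\<close>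
    define L Z where "L = lower_central G (Suc (Suc i))" and "Z = lower_central G (Suc i)"
    interpret L: normal L G unfolding L_def by (rule lower_central_normal)
    let ?\<pi> = "(#>) L"
    interpret Q: group "G Mod L" by (rule L.factorgroup_is_group)
    interpret \<pi>: group_hom G "G Mod L" ?\<pi>
      by (intro group_hom.intro group_hom_axioms.intro is_group Q.is_group L.r_coset_hom_Mod)
    have surj: "?\<pi> ` carrier G = carrier (G Mod L)" by (simp add: carrier_FactGroup)
    have Zsub: "Z \<subseteq> carrier G" unfolding Z_def using lower_central_subgroup subgroup.subset by blast
    have eq_iff: "?\<pi> a = ?\<pi> b \<longleftrightarrow> a \<otimes> inv b \<in> L" if "a \<in> carrier G" "b \<in> carrier G" for a b
    proof -
      have sL: "subgroup L G" by (rule L.subgroup_axioms)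
      have "?\<pi> a = ?\<pi> b \<longleftrightarrow> a \<in> ?\<pi> b"
        using that repr_independence[OF _ _ sL] rcos_self[OF _ sL] by blast
      also have "\<dots> \<longleftrightarrow> a \<otimes> inv b \<in> L"
        using that L.rcos_module[OF is_group, of b a] by blast
      finally show ?thesis .
    qed
    have "\<exists>k>0. ?\<pi> y [^]\<^bsub>G Mod L\<^esub> (k::nat) \<in> ?\<pi> ` H"
    proof (rule Q.power_in_subgroup_of_central)
      show "subgroup (?\<pi> ` H) (G Mod L)" using H by (rule \<pi>.subgroup_img_is_subgroup)
      show "lower_central (G Mod L) i \<subseteq> carrier (G Mod L)"
        using Q.lower_central_subgroup subgroup.subset by blast
      show "?\<pi> ` Z = generate (G Mod L)
          {Q.commutator a b | a b. a \<in> lower_central (G Mod L) i \<and> b \<in> carrier (G Mod L)}"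
        using \<pi>.lower_central_img[OF surj, of "Suc i"] by (simp add: Z_def)
    next
      fix z g assume "z \<in> ?\<pi> ` Z" "g \<in> carrier (G Mod L)"
      then obtain a b where ab: "a \<in> Z" "b \<in> carrier G" "z = ?\<pi> a" "g = ?\<pi> b"
        using surj by blast
      then have a: "a \<in> carrier G" using Zsub by blast
      have "a \<otimes> b \<otimes> inv (b \<otimes> a) \<in> L"
        using commutator_in_lower_central[OF ab(1)[unfolded Z_def] ab(2)] a ab(2) unfolding L_def[symmetric] by (simp add: inv_mult_group m_assoc)
      then have eq: "?\<pi> (a \<otimes> b) = ?\<pi> (b \<otimes> a)" using a ab(2) eq_iff[of "a \<otimes> b" "b \<otimes> a"] by (simp only: m_closed)
      show "z \<otimes>\<^bsub>G Mod L\<^esub> g = g \<otimes>\<^bsub>G Mod L\<^esub> z"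
        unfolding ab(3,4) \<pi>.hom_mult[OF a ab(2), symmetric] \<pi>.hom_mult[OF ab(2) a, symmetric]
        by (rule eq)
    next
      fix q assume "q \<in> carrier (G Mod L)"
      then obtain b where b: "b \<in> carrier G" "q = ?\<pi> b" using surj by blast
      obtain k where k: "k > 0" "b [^] (k::nat) \<in> H <#> Z" using Suc.IH b unfolding Z_def by blast
      have "?\<pi> (b [^] k) \<in> ?\<pi> ` H <#>\<^bsub>G Mod L\<^esub> ?\<pi> ` Z"
        using k(2) \<pi>.img_set_mult[OF subgroup.subset[OF H] Zsub] by blast
      then show "\<exists>k>0. q [^]\<^bsub>G Mod L\<^esub> (k::nat) \<in> ?\<pi> ` H <#>\<^bsub>G Mod L\<^esub> ?\<pi> ` Z"
        using k(1) b by (auto simp: \<pi>.hom_nat_pow)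
    next
      show "?\<pi> y \<in> carrier (G Mod L)" using Suc.prems by simp
    qed
    then obtain k h where k: "k > 0" "h \<in> H" "?\<pi> (y [^] (k::nat)) = ?\<pi> h"
      using Suc.prems by (auto simp: \<pi>.hom_nat_pow)
    have h: "h \<in> carrier G" using k H subgroup.subset by blast
    have "y [^] k \<in> L #> h"
      using k Suc.prems rcos_self[OF _ L.subgroup_axioms, of "y [^] k"] by simp
    \<comment> \<open>The left coset puts the factor from \<open>H\<close> first, as in
      \<open>H <#> L\<close>.\<close>
    then have "y [^] k \<in> h <# L" using L.coset_eq h by blast
    then have "y [^] k \<in> H <#> L" using k by (auto simp: l_coset_def set_mult_def)
    with k show ?case unfolding L_def by blast
  qed
  obtain c where c: "lower_central G c = {\<one>}"
    using nil by (auto simp: nilpotent_group_def)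
  \<comment> \<open>\<open>step\<close> speaks of successor indices only, hence one term beyond
    \<open>c\<close>.\<close>
  have "lower_central G (Suc c) \<subseteq> {\<one>}" using lower_central_Suc_subset[of c] c by simp
  then have "H <#> lower_central G (Suc c) \<subseteq> H"
    using subgroup.subset[OF H] by (auto simp: set_mult_def subset_iff)
  with step[OF y, of c] show ?thesis by blast
qed

text \<open>Writing \<open>[g, h]\<close> for the commutator, \<open>g h g^-1 = [g, h] h\<close>
  gives normality, and \<open>a b (b a)^-1 = [a, b]\<close> gives commutativity of the
  quotient.\<close>

lemma normal_of_commutators:
  assumes B: "subgroup B G"
    and comm: "\<And>a b. a \<in> carrier G \<Longrightarrow> b \<in> carrier G \<Longrightarrow> commutator a b \<in> B"
  shows "B \<lhd> G" "comm_group (G Mod B)"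
proof -
  show nB: "B \<lhd> G"
  proof (rule normal_invI[OF B])
    fix g h assume g: "g \<in> carrier G" and h: "h \<in> B"
    then have "commutator g h \<otimes> h \<in> B"
      using comm B by (meson subgroup.m_closed subgroup.mem_carrier)
    then show "g \<otimes> h \<otimes> inv g \<in> B"
      using g h subgroup.mem_carrier[OF B] by (simp add: m_assoc)
  qed
  interpret B: normal B G by fact
  interpret Q: group "G Mod B" by (rule B.factorgroup_is_group)
  show "comm_group (G Mod B)"
  proof (rule Q.group_comm_groupI)
    fix p q assume "p \<in> carrier (G Mod B)" "q \<in> carrier (G Mod B)"
    then obtain a b where ab: "a \<in> carrier G" "b \<in> carrier G" "p = B #> a" "q = B #> b"
      by (auto simp: carrier_FactGroup)
    have "a \<otimes> b \<otimes> inv (b \<otimes> a) \<in> B"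
      using comm ab by (simp add: inv_mult_group m_assoc)
    then have "a \<otimes> b \<in> B #> (b \<otimes> a)" using ab B.rcos_module is_group by simp
    then have "B #> (a \<otimes> b) = B #> (b \<otimes> a)"
      using ab B repr_independence by simp
    then show "p \<otimes>\<^bsub>G Mod B\<^esub> q = q \<otimes>\<^bsub>G Mod B\<^esub> p"
      using ab by (simp add: B.rcos_sum)
  qed
qed

end

section \<open>Rational-valued homomorphisms\<close>

context comm_group begin

text \<open>For a subgroup \<open>C\<close> maximal among those containing no positive power of \<open>x\<close>, every \<open>y\<close>
  satisfies \<open>y\<^sup>m \<in> x\<^sup>n C\<close> for some \<open>m \<noteq> 0\<close>, and \<open>y \<mapsto> n / m\<close> is the homomorphism.\<close>
lemma exists_real_hom:
  assumes x: "x \<in> carrier G" and inf: "\<And>n. n > 0 \<Longrightarrow> x [^] (n::nat) \<noteq> \<one>"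
  shows "\<exists>f :: 'a \<Rightarrow> real. f x = 1 \<and> (\<forall>a\<in>carrier G. f a \<in> \<rat>) \<and>
    (\<forall>a\<in>carrier G. \<forall>b\<in>carrier G. f (a \<otimes> b) = f a + f b)"
proof -
  define \<A> where "\<A> = {C. subgroup C G \<and> (\<forall>n>0. x [^] (n::nat) \<notin> C)}"
  have "\<exists>C\<in>\<A>. \<forall>X\<in>\<A>. C \<subseteq> X \<longrightarrow> X = C"
  proof (rule subset_Zorn_nonempty)
    have "{\<one>} \<in> \<A>" using inf triv_subgroup by (auto simp: \<A>_def)
    then show "\<A> \<noteq> {}" by blast
  next
    fix \<C> assume ne: "\<C> \<noteq> {}" and ch: "subset.chain \<A> \<C>"
    have sub: "subgroup C G" if "C \<in> \<C>" for C
      using ch that by (auto simp: subset.chain_def \<A>_def)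
    have "subgroup (\<Union>\<C>) G"
    proof (rule subgroupI)
      show "\<Union>\<C> \<subseteq> carrier G" using sub subgroup.subset by blast
      show "\<Union>\<C> \<noteq> {}" using ne sub[THEN subgroup.one_closed] by auto
      show "inv a \<in> \<Union>\<C>" if "a \<in> \<Union>\<C>" for a
        using that sub[THEN subgroup.m_inv_closed] by auto
      show "a \<otimes> b \<in> \<Union>\<C>" if a: "a \<in> \<Union>\<C>" and b: "b \<in> \<Union>\<C>" for a b
      proof -
        obtain A B where AB: "A \<in> \<C>" "B \<in> \<C>" "a \<in> A" "b \<in> B" using a b by blast
        then have "A \<subseteq> B \<or> B \<subseteq> A" using ch by (auto simp: subset.chain_def)
        then show ?thesis using AB sub[THEN subgroup.m_closed] by (metis UnionI subsetD)
      qed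
    qed
    then show "\<Union>\<C> \<in> \<A>" using ch by (auto simp: subset.chain_def \<A>_def)
  qed
  then obtain C where "C \<in> \<A>" "\<forall>X\<in>\<A>. C \<subseteq> X \<longrightarrow> X = C" by blast
  then have C: "subgroup C G" and xC: "\<And>n. n > 0 \<Longrightarrow> x [^] (n::nat) \<notin> C"
    and max: "\<And>X. subgroup X G \<Longrightarrow> (\<And>n. n > 0 \<Longrightarrow> x [^] (n::nat) \<notin> X) \<Longrightarrow> C \<subseteq> X \<Longrightarrow> X = C"
    by (auto simp: \<A>_def)
  interpret C: subgroup C G by fact
  have Cpow: "c [^] (m::int) \<in> C" if "c \<in> C" for c m
    using subgroup_int_pow_closed[OF C that] .
  have xint: "m = 0" if "x [^] (m::int) \<in> C" for m
  proof (rule ccontr)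
    assume "m \<noteq> 0"
    have "x [^] \<bar>m\<bar> \<in> C"
      using that C.m_inv_closed[OF that] x by (cases "m \<ge> 0") (auto simp: int_pow_neg)
    then have "x [^] nat \<bar>m\<bar> \<in> C" by (metis abs_ge_zero int_pow_int nat_0_le)
    with xC[of "nat \<bar>m\<bar>"] \<open>m \<noteq> 0\<close> show False by simp
  qed
  have ex: "\<exists>m n. m \<noteq> 0 \<and> y [^] (m::int) \<otimes> x [^] (- n::int) \<in> C" if y: "y \<in> carrier G" for y
  proof (cases "y \<in> C")
    case True
    then show ?thesis using y by (intro exI[of _ 1] exI[of _ 0]) simp
  next
    case False
    \<comment> \<open>\<open>D\<close> is the subgroup generated by \<open>C\<close> and
      \<open>y\<close>. Being larger than the maximal \<open>C\<close>, it contains a relation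
      \<open>x^n = c y^j\<close> with \<open>n > 0\<close>.\<close>
    define D where "D = C <#> range (\<lambda>j::int. y [^] j)"
    have "range (\<lambda>j::int. y [^] j) = generate G {y}" using generate_pow[OF y] by blast
    then have D: "subgroup D G" unfolding D_def
      using mult_subgroups[OF C] generate_is_subgroup y by simp
    have "C \<subseteq> D"
    proof
      fix c assume "c \<in> C"
      then have "c \<otimes> y [^] (0::int) \<in> D" unfolding D_def set_mult_def by blast
      then show "c \<in> D" using \<open>c \<in> C\<close> by simp
    qed
    have "y \<in> D"
    proof -
      have "\<one> \<otimes> y [^] (1::int) \<in> D" unfolding D_def set_mult_def using C.one_closed by blast
      then show ?thesis using y by (simp only: int_pow_1[OF y] l_one[OF y])
    qed
    then have "D \<noteq> C" using False by blast
    with max[OF D _ \<open>C \<subseteq> D\<close>] obtain n where n: "n > 0" "x [^] (n::nat) \<in> D"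
      by metis
    then obtain c j where c: "c \<in> C" "x [^] n = c \<otimes> y [^] (j::int)"
      by (auto simp: D_def set_mult_def)
    \<comment> \<open>For \<open>j = 0\<close> the power of \<open>x\<close> itself would lie in
      \<open>C\<close>.\<close>
    have "j \<noteq> 0" using xC[OF n(1)] c by (intro notI) simp
    moreover have "y [^] j \<otimes> x [^] (- int n) = inv c"
    proof -
      have "x [^] (- int n) = inv (c \<otimes> y [^] j)"
        using x c(2) by (simp add: int_pow_neg_int)
      also have "\<dots> = inv (y [^] j) \<otimes> inv c" using c(1) y by (simp add: inv_mult_group)
      finally show ?thesis using c(1) y by (simp add: inv_mult_cancel)
    qed
    ultimately show ?thesis using c C.m_inv_closed by metis
  qed
  have uniq: "real_of_int n / of_int m = of_int n' / of_int m'"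
    if "m \<noteq> 0" "m' \<noteq> 0" "y [^] m \<otimes> x [^] (- n) \<in> C" "y [^] m' \<otimes> x [^] (- n') \<in> C"
      and y: "y \<in> carrier G" for y and m n m' n' :: int
  proof -
    \<comment> \<open>These exponents cancel \<open>y\<close> and leave a power of \<open>x\<close>
      in \<open>C\<close>, whose exponent must vanish by \<open>xint\<close>.\<close>
    have "(y [^] m \<otimes> x [^] (- n)) [^] m' \<otimes> (y [^] m' \<otimes> x [^] (- n')) [^] (- m) \<in> C"
      using that Cpow by blast
    also have "(y [^] m \<otimes> x [^] (- n)) [^] m' \<otimes> (y [^] m' \<otimes> x [^] (- n')) [^] (- m)
        = (y [^] (m * m') \<otimes> y [^] (- (m * m'))) \<otimes> (x [^] (- n * m') \<otimes> x [^] (n' * m))"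
      using x y by (simp add: int_pow_distrib int_pow_pow m_ac mult.commute)
    also have "\<dots> = x [^] (n' * m - n * m')"
      using x y int_pow_mult[OF y, of "m * m'" "- (m * m')"]
        int_pow_mult[OF x, of "- n * m'" "n' * m"] by (simp add: add.commute)
    finally have "n' * m = n * m'" using xint[of "n' * m - n * m'"] by simp
    then have "real_of_int n' * of_int m = of_int n * of_int m'" by (metis of_int_mult)
    then show ?thesis using that(1,2) by (simp add: field_simps)
  qed
  \<comment> \<open>By \<open>uniq\<close> the chosen quotient does not depend on the relation that
    produces it.\<close>
  define f where "f y = (SOME q. \<exists>m n. m \<noteq> 0 \<and> y [^] (m::int) \<otimes> x [^] (- n::int) \<in> C
      \<and> q = real_of_int n / of_int m)" for y
  have feq: "f y = of_int n / of_int m"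
    if "y \<in> carrier G" "m \<noteq> 0" "y [^] m \<otimes> x [^] (- n) \<in> C" for y and m n :: int
  proof -
    have "\<exists>q m n. m \<noteq> 0 \<and> y [^] (m::int) \<otimes> x [^] (- n::int) \<in> C \<and> q = real_of_int n / of_int m"
      using that by blast
    from someI_ex[OF this, folded f_def] obtain m' n' :: int where
      "m' \<noteq> 0" "y [^] m' \<otimes> x [^] (- n') \<in> C" "f y = of_int n' / of_int m'" by blast
    then show ?thesis using uniq[of m' m y n' n] that by simp
  qed
  have "f x = 1" using feq[of x 1 1] x by (simp add: int_pow_neg)
  moreover have "f a \<in> \<rat>" if a: "a \<in> carrier G" for a
    using ex[OF a] feq[OF a] by (metis Rats_divide Rats_of_int)
  moreover have "f (a \<otimes> b) = f a + f b" if a: "a \<in> carrier G" and b: "b \<in> carrier G" for a b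
  proof -
    obtain m n where m: "m \<noteq> 0" "a [^] (m::int) \<otimes> x [^] (- n::int) \<in> C" using ex[OF a] by blast
    obtain k l where k: "k \<noteq> 0" "b [^] (k::int) \<otimes> x [^] (- l::int) \<in> C" using ex[OF b] by blast
    \<comment> \<open>Raising to \<open>k\<close> and \<open>m\<close> gives \<open>a\<close> and
      \<open>b\<close> the common exponent \<open>m * k\<close>, so the relations multiply to one
      for \<open>a \<otimes> b\<close>.\<close>
    have "(a [^] m \<otimes> x [^] (- n)) [^] k \<otimes> (b [^] k \<otimes> x [^] (- l)) [^] m \<in> C"
      using m k Cpow by blast
    also have "(a [^] m \<otimes> x [^] (- n)) [^] k \<otimes> (b [^] k \<otimes> x [^] (- l)) [^] m
        = (a \<otimes> b) [^] (m * k) \<otimes> (x [^] (- n * k) \<otimes> x [^] (- l * m))"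
      using x a b by (simp add: int_pow_distrib int_pow_pow m_ac mult.commute)
    also have "\<dots> = (a \<otimes> b) [^] (m * k) \<otimes> x [^] (- (n * k + l * m))"
      using x by (simp add: int_pow_mult[symmetric])
    finally have "f (a \<otimes> b) = of_int (n * k + l * m) / of_int (m * k)"
      using m k a b by (intro feq) auto
    also have "\<dots> = of_int n / of_int m + of_int l / of_int k"
      using m k by (simp add: field_simps)
    finally show ?thesis using feq m k a b by simp
  qed
  ultimately show ?thesis by blast
qed

end

text \<open>The homomorphism comes from the abelian quotient by \<open>B = H [G, G]\<close>. If all
  elements of that quotient had finite order, \<open>power_in_subgroup_of_nilpotent\<close> would
  give \<open>y\<close> a positive power in \<open>H\<close>.\<close>

lemma (in group) exists_real_hom_vanishing:
  assumes nil: "nilpotent_group G" and H: "subgroup H G"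
    and y: "y \<in> carrier G" "\<And>k. k > 0 \<Longrightarrow> y [^] (k::nat) \<notin> H"
  shows "\<exists>f :: 'a \<Rightarrow> real. (\<exists>a\<in>carrier G. f a \<noteq> 0) \<and> (\<forall>a\<in>H. f a = 0) \<and>
    (\<forall>a\<in>carrier G. f a \<in> \<rat>) \<and> (\<forall>a\<in>carrier G. \<forall>b\<in>carrier G. f (a \<otimes> b) = f a + f b)"
proof -
  define B where "B = H <#> lower_central G (Suc 0)"
  obtain z where z: "z \<in> carrier G" "\<And>k. k > 0 \<Longrightarrow> z [^] (k::nat) \<notin> B"
    using power_in_subgroup_of_nilpotent[OF nil H _ y(1)] y(2) unfolding B_def by blast
  have B_eq: "B = lower_central G (Suc 0) <#> H" unfolding B_def
    using commut_normal[OF H lower_central_normal] .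
  have B: "subgroup B G" unfolding B_eq by (rule mult_norm_subgroup[OF lower_central_normal H])
  have "commutator a b \<in> B" if "a \<in> carrier G" "b \<in> carrier G" for a b
  proof -
    have "commutator a b \<in> lower_central G (Suc 0)"
      by (rule commutator_in_lower_central) (use that in simp_all)
    then have "\<one> \<otimes> commutator a b \<in> B"
      unfolding B_def set_mult_def using subgroup.one_closed[OF H] by blast
    then show ?thesis using that by simp
  qed
  note nB = normal_of_commutators[OF B this]
  interpret B: normal B G by (rule nB)
  interpret Q: comm_group "G Mod B" by (rule nB)
  have Bz: "B #> z \<in> carrier (G Mod B)" using z by (auto simp: carrier_FactGroup)
  have "(B #> z) [^]\<^bsub>G Mod B\<^esub> k \<noteq> \<one>\<^bsub>G Mod B\<^esub>" if "k > 0" for k :: nat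
    using z(2)[OF that] z(1) rcos_self[OF _ B.subgroup_axioms, of "z [^] k"]
    by (auto simp: B.FactGroup_pow)
  from Q.exists_real_hom[OF Bz this] obtain f :: "'a set \<Rightarrow> real" where f: "f (B #> z) = 1"
    "\<forall>a\<in>carrier (G Mod B). f a \<in> \<rat>"
    "\<forall>a\<in>carrier (G Mod B). \<forall>b\<in>carrier (G Mod B). f (a \<otimes>\<^bsub>G Mod B\<^esub> b) = f a + f b"
    by blast
  have mem: "B #> a \<in> carrier (G Mod B)" if "a \<in> carrier G" for a
    using that by (auto simp: carrier_FactGroup)
  have add: "f (B #> (a \<otimes> b)) = f (B #> a) + f (B #> b)" if "a \<in> carrier G" "b \<in> carrier G" for a b
    using bspec[OF bspec[OF f(3) mem] mem] that by (simp add: B.rcos_sum)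
  have zero: "f (B #> a) = 0" if "a \<in> H" for a
  proof -
    have "a \<otimes> \<one> \<in> B" unfolding B_def set_mult_def
      using that subgroup.one_closed[OF lower_central_subgroup] by blast
    then have "B #> a = B #> \<one>" using that B.rcos_const is_group subgroup.mem_carrier[OF H]
      by simp
    then show ?thesis using add[of \<one> \<one>] by simp
  qed
  show ?thesis
    using f(1) z add zero f(2) mem by (intro exI[of _ "\<lambda>a. f (B #> a)"]) (auto intro!: bexI[of _ z])
qed

section \<open>Polynomial functions modulo a subgroup\<close>

text \<open>Degree less than \<open>n\<close> modulo \<open>Z\<close>; hence the degree \<open>d\<close> of the definition corresponds to
  \<open>n = d + 1\<close>.\<close>
primrec polynomial_mod :: "('a, 'b) monoid_scheme \<Rightarrow> 'r::ab_group_add set \<Rightarrow> nat \<Rightarrow> ('a \<Rightarrow> 'r) \<Rightarrow> bool" where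
  "polynomial_mod G Z 0 F \<longleftrightarrow> (\<forall>x\<in>carrier G. F x \<in> Z)"
| "polynomial_mod G Z (Suc n) F \<longleftrightarrow>
     (\<forall>u\<in>carrier G. polynomial_mod G Z n (\<lambda>x. F (x \<otimes>\<^bsub>G\<^esub> u) - F x))"

text \<open>Additive subgroups as plain sets: closure under differences yields negatives and sums.
  The coefficient sets of interest are the integers and the multiples of \<open>p\<close>.\<close>

definition additive_subset :: "'r::ab_group_add set \<Rightarrow> bool" where
  "additive_subset Z \<longleftrightarrow> 0 \<in> Z \<and> (\<forall>a\<in>Z. \<forall>b\<in>Z. a - b \<in> Z)"

lemma additive_subset_zero: "additive_subset Z \<Longrightarrow> 0 \<in> Z"
  and additive_subset_diff: "additive_subset Z \<Longrightarrow> a \<in> Z \<Longrightarrow> b \<in> Z \<Longrightarrow> a - b \<in> Z"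
  by (auto simp: additive_subset_def)

lemma additive_subset_add: "additive_subset Z \<Longrightarrow> a \<in> Z \<Longrightarrow> b \<in> Z \<Longrightarrow> a + b \<in> Z"
  by (metis additive_subset_def diff_diff_eq2 diff_zero)

lemma additive_subset_uminus: "additive_subset Z \<Longrightarrow> a \<in> Z \<Longrightarrow> - a \<in> Z"
  using additive_subset_diff[of Z 0 a] additive_subset_zero[of Z] by simp

lemma additive_subset_Ints: "additive_subset (\<int> :: 'a::ring_1 set)"
  by (auto simp: additive_subset_def)

lemma additive_subset_multiples: "additive_subset {k. (p::int) dvd k}"
  by (auto simp: additive_subset_def)

lemma polynomial_mod_mono:
  assumes "Z \<subseteq> Z'" "polynomial_mod G Z n F"
  shows "polynomial_mod G Z' n F"
  using assms(2) by (induction n arbitrary: F) (use assms(1) in auto)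

context group begin

lemma polynomial_mod_diff:
  assumes "additive_subset Z" "polynomial_mod G Z n F" "polynomial_mod G Z n F'"
  shows "polynomial_mod G Z n (\<lambda>x. F x - F' x)"
  using assms(2,3)
proof (induction n arbitrary: F F')
  case 0
  then show ?case using assms(1) by (auto intro: additive_subset_diff)
next
  case (Suc n)
  have eq: "F (x \<otimes> u) - F' (x \<otimes> u) - (F x - F' x) = F (x \<otimes> u) - F x - (F' (x \<otimes> u) - F' x)" for x u
    by simp
  show ?case unfolding polynomial_mod.simps eq using Suc by simp
qed

lemma polynomial_mod_carrier_cong:
  assumes "polynomial_mod G Z n F" "\<And>x. x \<in> carrier G \<Longrightarrow> F x = F' x"
  shows "polynomial_mod G Z n F'"
  using assms
proof (induction n arbitrary: F F')
  case 0
  then show ?case by simp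
next
  case (Suc n)
  show ?case
    unfolding polynomial_mod.simps
  proof
    fix u assume u: "u \<in> carrier G"
    show "polynomial_mod G Z n (\<lambda>x. F' (x \<otimes> u) - F' x)"
      by (rule Suc.IH[of "\<lambda>x. F (x \<otimes> u) - F x"]) (use Suc.prems u in auto)
  qed
qed

text \<open>In a noncommutative group, translation by \<open>u\<close> turns the derivative in
  direction \<open>v\<close> into one in the conjugate direction:
  \<open>x v u = x u (u^-1 v u)\<close>.\<close>

lemma polynomial_mod_translate:
  assumes "polynomial_mod G Z n F" "u \<in> carrier G"
  shows "polynomial_mod G Z n (\<lambda>x. F (x \<otimes> u))"
  using assms(1)
proof (induction n arbitrary: F)
  case 0
  then show ?case using assms(2) by auto
next
  case (Suc n)
  show ?case
    unfolding polynomial_mod.simps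
  proof
    fix v assume v: "v \<in> carrier G"
    let ?w = "inv u \<otimes> v \<otimes> u"
    have "polynomial_mod G Z n (\<lambda>x. F (x \<otimes> u \<otimes> ?w) - F (x \<otimes> u))"
      using Suc.IH[of "\<lambda>x. F (x \<otimes> ?w) - F x"] Suc.prems v assms(2) by simp
    then show "polynomial_mod G Z n (\<lambda>x. F (x \<otimes> v \<otimes> u) - F (x \<otimes> u))"
    proof (rule polynomial_mod_carrier_cong)
      fix x assume "x \<in> carrier G"
      then have "x \<otimes> u \<otimes> ?w = x \<otimes> v \<otimes> u"
        using v assms(2) by (metis inv_closed inv_solve_left m_assoc m_closed)
      then show "F (x \<otimes> u \<otimes> ?w) - F (x \<otimes> u) = F (x \<otimes> v \<otimes> u) - F (x \<otimes> u)" by simp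
    qed
  qed
qed

text \<open>Each derivative is the difference of a translate of \<open>F\<close> and
  \<open>F\<close> itself, and both satisfy the bound \<open>n\<close>.\<close>

lemma polynomial_mod_Suc:
  assumes "additive_subset Z" "polynomial_mod G Z n F"
  shows "polynomial_mod G Z (Suc n) F"
  using polynomial_mod_diff[OF assms(1) polynomial_mod_translate[OF assms(2)] assms(2)] by simp

lemma polynomial_mod_zero:
  assumes "additive_subset Z" "\<And>x. x \<in> carrier G \<Longrightarrow> F x \<in> Z"
  shows "polynomial_mod G Z n F"
  using assms polynomial_mod_Suc by (induction n) (auto simp del: polynomial_mod.simps(2))

lemma polynomial_mod_cong:
  assumes Z: "additive_subset Z" and "\<And>x. x \<in> carrier G \<Longrightarrow> F x - F' x \<in> Z"
    and "polynomial_mod G Z n F"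
  shows "polynomial_mod G Z n F'"
proof -
  have "polynomial_mod G Z n (\<lambda>x. F x - F' x)" by (rule polynomial_mod_zero[OF assms(1,2)])
  from polynomial_mod_diff[OF Z assms(3) this] show ?thesis by simp
qed

text \<open>The elements \<open>u\<close> whose increments all lie in \<open>Z\<close> form a
  subgroup, by telescoping. Congruences for \<open>F\<close> can thus be checked on
  generators.\<close>

lemma shift_in_generate:
  assumes Z: "additive_subset Z" and S: "S \<subseteq> carrier G"
    and shift: "\<And>s y. s \<in> S \<Longrightarrow> y \<in> carrier G \<Longrightarrow> F (y \<otimes> s) - F y \<in> Z"
    and "u \<in> generate G S" "y \<in> carrier G"
  shows "F (y \<otimes> u) - F y \<in> Z"
  using assms(4,5)
proof (induction arbitrary: y)
  case one
  then show ?case using additive_subset_zero[OF Z] by simp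
next
  case (incl h)
  then show ?case using shift by blast
next
  case (inv h)
  have h: "h \<in> carrier G" using inv S by blast
  have "F (y \<otimes> inv h \<otimes> h) - F (y \<otimes> inv h) \<in> Z" using shift inv h by simp
  moreover have "y \<otimes> inv h \<otimes> h = y" using inv h by (simp add: m_assoc)
  ultimately show ?case using additive_subset_uminus[OF Z] by fastforce
next
  case (eng h1 h2)
  have h: "h1 \<in> carrier G" "h2 \<in> carrier G" using eng S generate_in_carrier by blast+
  have "F (y \<otimes> h1 \<otimes> h2) - F (y \<otimes> h1) \<in> Z" "F (y \<otimes> h1) - F y \<in> Z"
    using eng h by auto
  from additive_subset_add[OF Z this] show ?case using h eng.prems by (simp add: m_assoc)
qed

text \<open>By induction on the degree, the derivative along each of the finitely many generators
  has a common denominator. Their product, times the denominator of \<open>F \<one>\<close>, works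
  for \<open>F\<close>.\<close>

lemma bounded_denominators:
  fixes F :: "'a \<Rightarrow> real"
  assumes S: "finite S" "S \<subseteq> carrier G" "generate G S = carrier G"
    and "polynomial_mod G {0} n F" "\<And>x. x \<in> carrier G \<Longrightarrow> F x \<in> \<rat>"
  shows "\<exists>D::int. D > 0 \<and> (\<forall>x\<in>carrier G. of_int D * F x \<in> \<int>)"
  using assms(4,5)
proof (induction n arbitrary: F)
  case 0
  then show ?case by (intro exI[of _ 1]) auto
next
  case (Suc n)
  have "\<exists>D::int. D > 0 \<and> (\<forall>x\<in>carrier G. of_int D * (F (x \<otimes> s) - F x) \<in> \<int>)" if "s \<in> S" for s
    using Suc.prems S that by (intro Suc.IH) auto
  then obtain D :: "'a \<Rightarrow> int" where D: "\<And>s. s \<in> S \<Longrightarrow> D s > 0"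
    "\<And>s x. s \<in> S \<Longrightarrow> x \<in> carrier G \<Longrightarrow> of_int (D s) * (F (x \<otimes> s) - F x) \<in> \<int>"
    by metis
  obtain a b :: int where ab: "b > 0" "F \<one> = of_int a / of_int b"
    using Suc.prems(2)[of \<one>] by (auto elim: Rats_cases')
  define E where "E = b * prod D S"
  have "E > 0" using ab D(1) by (auto simp: E_def intro!: mult_pos_pos prod_pos)
  moreover have "of_int E * F x \<in> \<int>" if x: "x \<in> carrier G" for x
  proof -
    have "of_int E * F (\<one> \<otimes> x) - of_int E * F \<one> \<in> \<int>"
    proof (rule shift_in_generate[OF additive_subset_Ints S(2)])
      fix s y assume s: "s \<in> S" and y: "y \<in> carrier G"
      have "D s dvd E" using dvd_prodI[OF S(1) s, of D] by (simp add: E_def)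
      then obtain k where k: "E = D s * k" by blast
      have "of_int E * F (y \<otimes> s) - of_int E * F y = of_int k * (of_int (D s) * (F (y \<otimes> s) - F y))"
        unfolding k by (simp add: algebra_simps)
      also have "\<dots> \<in> \<int>" using D(2)[OF s y] by simp
      finally show "of_int E * F (y \<otimes> s) - of_int E * F y \<in> \<int>" .
    qed (use x S in auto)
    moreover have "of_int E * F \<one> = of_int (a * prod D S)"
      unfolding ab(2) E_def using ab(1) by simp
    ultimately show ?thesis using x
      by (metis Ints_add Ints_of_int diff_add_cancel l_one)
  qed
  ultimately show ?case by blast
qed

text \<open>A polynomial is determined by its value at \<open>\<one>\<close> and its derivatives along generators.\<close>
lemma finite_polynomials_mod:
  fixes p :: int
  assumes S: "finite S" "S \<subseteq> carrier G" "generate G S = carrier G" and p: "p > 0"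
  shows "finite {F. polynomial_mod G {k. p dvd k} n F \<and> (\<forall>x\<in>carrier G. F x \<in> {0..<p}) \<and>
    (\<forall>x. x \<notin> carrier G \<longrightarrow> F x = 0)}"
    (is "finite (?P n)")
proof (induction n)
  case 0
  have "?P 0 \<subseteq> {\<lambda>_. 0}"
  proof (rule subsetI, unfold singleton_iff, rule ext)
    fix F x assume F: "F \<in> ?P 0"
    show "F x = 0"
    proof (cases "x \<in> carrier G")
      case True
      then have "p dvd F x" "F x \<in> {0..<p}" using F by auto
      then show ?thesis using zdvd_not_zless[of "F x" p] by force
    qed (use F in simp)
  qed
  then show ?case by (rule finite_subset) simp
next
  case (Suc n)
  \<comment> \<open>Increments are reduced modulo \<open>p\<close> and set to zero off the carrier,
    so that they land in \<open>?P n\<close>.\<close>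
  let ?d = "\<lambda>F s x. if x \<in> carrier G then (F (x \<otimes> s) - F x) mod p else 0"
  let ?\<Phi> = "\<lambda>F. (F \<one>, \<lambda>s\<in>S. ?d F s)"
  have "?\<Phi> ` ?P (Suc n) \<subseteq> {0..<p} \<times> (S \<rightarrow>\<^sub>E ?P n)"
  proof (rule image_subsetI)
    fix F assume F: "F \<in> ?P (Suc n)"
    have "?d F s \<in> ?P n" if "s \<in> S" for s
    proof -
      have "polynomial_mod G {k. p dvd k} n (\<lambda>x. F (x \<otimes> s) - F x)" using F S that by auto
      then have "polynomial_mod G {k. p dvd k} n (?d F s)"
        by (rule polynomial_mod_cong[OF additive_subset_multiples, rotated]) (auto simp: dvd_minus_mod)
      then show ?thesis using p by auto
    qed
    then show "?\<Phi> F \<in> {0..<p} \<times> (S \<rightarrow>\<^sub>E ?P n)" using F by auto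
  qed
  then have "finite (?\<Phi> ` ?P (Suc n))"
    by (rule finite_subset) (intro finite_cartesian_product finite_PiE S Suc; simp)
  moreover have "inj_on ?\<Phi> (?P (Suc n))"
  proof (rule inj_onI)
    fix F F' assume F: "F \<in> ?P (Suc n)" "F' \<in> ?P (Suc n)" and eq: "?\<Phi> F = ?\<Phi> F'"
    have one: "F \<one> = F' \<one>" and "(\<lambda>s\<in>S. ?d F s) = (\<lambda>s\<in>S. ?d F' s)"
      using eq by (simp_all only: prod.inject)
    then have d: "?d F s = ?d F' s" if "s \<in> S" for s
      using that restrict_apply'[of s S "?d F"] restrict_apply'[of s S "?d F'"] by metis
    show "F = F'"
    proof
      fix x
      show "F x = F' x"
      proof (cases "x \<in> carrier G")
        case True
        \<comment> \<open>Modulo \<open>p\<close>, the increments of \<open>F - F'\<close> along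
          generators vanish, so \<open>F - F'\<close> is constant, with value zero at
          \<open>\<one>\<close>.\<close>
        have "(F (\<one> \<otimes> x) - F' (\<one> \<otimes> x)) - (F \<one> - F' \<one>) \<in> {k. p dvd k}"
        proof (rule shift_in_generate[OF additive_subset_multiples S(2), where F = "\<lambda>x. F x - F' x"])
          fix s y assume "s \<in> S" "y \<in> carrier G"
          with fun_cong[OF d, of s y] have "(F (y \<otimes> s) - F y) mod p = (F' (y \<otimes> s) - F' y) mod p"
            by simp
          then show "(F (y \<otimes> s) - F' (y \<otimes> s)) - (F y - F' y) \<in> {k. p dvd k}"
            by (simp add: mod_eq_dvd_iff algebra_simps)
        qed (use True S in auto)
        then have "p dvd F x - F' x" using one True by simp
        then have "F x mod p = F' x mod p" by (simp add: mod_eq_dvd_iff)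
        then show ?thesis using F True by simp
      qed (use F in auto)
    qed
  qed
  ultimately show ?case by (rule finite_imageD)
qed

text \<open>\<open>K\<close> is the kernel of the action of \<open>G\<close> by translation on the finite set of reduced
  polynomials.\<close>
lemma exists_common_period:
  fixes p :: int
  assumes S: "finite S" "S \<subseteq> carrier G" "generate G S = carrier G" and p: "p > 0"
  obtains K where "K \<lhd> G" "finite (rcosets K)"
    "\<And>F x k. polynomial_mod G {k. p dvd k} n F \<Longrightarrow> x \<in> carrier G \<Longrightarrow> k \<in> K \<Longrightarrow> p dvd F (x \<otimes> k) - F x"
proof -
  define P where "P = {F. polynomial_mod G {k. p dvd k} n F \<and> (\<forall>x\<in>carrier G. F x \<in> {0..<p}) \<and>
    (\<forall>x. x \<notin> carrier G \<longrightarrow> F x = 0)}"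
  have finP: "finite P" unfolding P_def by (rule finite_polynomials_mod[OF assms])
  define R where "R g F = (\<lambda>x. if x \<in> carrier G then F (x \<otimes> g) else 0)" for g and F :: "'a \<Rightarrow> int"
  have RP: "R g F \<in> P" if "g \<in> carrier G" "F \<in> P" for g F
  proof -
    have "polynomial_mod G {k. p dvd k} n (\<lambda>x. F (x \<otimes> g))"
      using that polynomial_mod_translate by (auto simp: P_def)
    then have "polynomial_mod G {k. p dvd k} n (R g F)"
      by (rule polynomial_mod_cong[OF additive_subset_multiples, rotated]) (auto simp: R_def)
    then show ?thesis using that by (auto simp: P_def R_def)
  qed
  define K where "K = {k \<in> carrier G. \<forall>F\<in>P. \<forall>x\<in>carrier G. F (x \<otimes> k) = F x}"
  have Ksub: "subgroup K G"
  proof (rule subgroupI)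
    show "K \<subseteq> carrier G" by (auto simp: K_def)
    show "K \<noteq> {}" using one_closed by (auto simp: K_def intro!: exI[of _ \<one>])
  next
    fix k assume k: "k \<in> K"
    then have kG: "k \<in> carrier G" by (simp add: K_def)
    have "F (x \<otimes> inv k) = F x" if "F \<in> P" "x \<in> carrier G" for F x
    proof -
      have "F (x \<otimes> inv k \<otimes> k) = F (x \<otimes> inv k)" using k that kG by (simp add: K_def)
      then show ?thesis using that kG by (simp add: m_assoc)
    qed
    then show "inv k \<in> K" using kG by (simp add: K_def)
  next
    fix k l assume kl: "k \<in> K" "l \<in> K"
    then have G: "k \<in> carrier G" "l \<in> carrier G" by (simp_all add: K_def)
    have "F (x \<otimes> (k \<otimes> l)) = F x" if F: "F \<in> P" and x: "x \<in> carrier G" for F x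
    proof -
      have "F (x \<otimes> k \<otimes> l) = F (x \<otimes> k)" "F (x \<otimes> k) = F x" using kl F G x by (auto simp: K_def)
      then show ?thesis using G x by (simp add: m_assoc)
    qed
    then show "k \<otimes> l \<in> K" using G by (simp add: K_def)
  qed
  have "K \<lhd> G"
  proof (rule normal_invI[OF Ksub])
    fix g k assume g: "g \<in> carrier G" and k: "k \<in> K"
    then have kG: "k \<in> carrier G" by (simp add: K_def)
    have "F (x \<otimes> (g \<otimes> k \<otimes> inv g)) = F x" if F: "F \<in> P" and x: "x \<in> carrier G" for F x
    proof -
      \<comment> \<open>\<open>P\<close> is stable under translation, so the invariance under
        \<open>k\<close> may be applied to the translate by \<open>inv g\<close>, at the point
        \<open>x \<otimes> g\<close>.\<close>
      have "R (inv g) F (x \<otimes> g \<otimes> k) = R (inv g) F (x \<otimes> g)"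
        using k RP[of "inv g" F] F g x by (simp add: K_def)
      then show ?thesis using g kG x by (simp add: R_def m_assoc)
    qed
    then show "g \<otimes> k \<otimes> inv g \<in> K" using g kG by (simp add: K_def)
  qed
  moreover have "finite (rcosets K)"
  proof -
    \<comment> \<open>\<open>A g\<close> records how \<open>g\<close> acts on the finite set
      \<open>P\<close>. There are finitely many such maps, and each determines the coset of
      \<open>K\<close>.\<close>
    define A where "A g = (\<lambda>F\<in>P. R g F)" for g
    have "A ` carrier G \<subseteq> P \<rightarrow>\<^sub>E P" using RP by (auto simp: A_def)
    then have fin: "finite (A ` carrier G)"
      by (rule finite_subset) (intro finite_PiE finP)
    have coset: "K #> g = K #> h" if g: "g \<in> carrier G" and h: "h \<in> carrier G" and eq: "A g = A h" for g h
    proof -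
      have "F (x \<otimes> (g \<otimes> inv h)) = F x" if F: "F \<in> P" and x: "x \<in> carrier G" for F x
      proof -
        \<comment> \<open>On the translate by \<open>inv h\<close>, equality of the two actions says
          that \<open>F\<close> is invariant under \<open>g \<otimes> inv h\<close>.\<close>
        have "A g (R (inv h) F) x = A h (R (inv h) F) x" using eq by simp
        then show ?thesis using RP[of "inv h" F] F g h x by (simp add: A_def R_def m_assoc)
      qed
      then have "g \<otimes> inv h \<in> K" using g h by (simp add: K_def)
      then have "g \<in> K #> h" using subgroup.rcos_module_rev[OF Ksub is_group] g h by blast
      then show ?thesis using repr_independence[OF _ h Ksub] by blast
    qed
    have "rcosets K \<subseteq> (\<lambda>a. K #> (SOME g. g \<in> carrier G \<and> A g = a)) ` (A ` carrier G)"
    proof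
      fix q assume "q \<in> rcosets K"
      then obtain g where g: "g \<in> carrier G" "q = K #> g" by (auto simp: RCOSETS_def)
      let ?h = "SOME h. h \<in> carrier G \<and> A h = A g"
      have "?h \<in> carrier G \<and> A ?h = A g" by (rule someI[of _ g]) (use g in simp)
      then have "q = K #> ?h" using coset g by metis
      then show "q \<in> (\<lambda>a. K #> (SOME g. g \<in> carrier G \<and> A g = a)) ` (A ` carrier G)"
        using g by blast
    qed
    then show ?thesis using fin by (meson finite_imageI finite_subset)
  qed
  moreover have "p dvd F (x \<otimes> k) - F x"
    if F: "polynomial_mod G {k. p dvd k} n F" and x: "x \<in> carrier G" and k: "k \<in> K" for F x k
  proof -
    define F' where "F' x = (if x \<in> carrier G then F x mod p else 0)" for x
    have "polynomial_mod G {k. p dvd k} n F'"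
      by (rule polynomial_mod_cong[OF additive_subset_multiples _ F]) (auto simp: F'_def dvd_minus_mod)
    then have "F' \<in> P" using p by (auto simp: P_def F'_def)
    then have "F' (x \<otimes> k) = F' x" using k x by (simp add: K_def)
    then show ?thesis using x k by (simp add: F'_def K_def mod_eq_dvd_iff)
  qed
  ultimately show thesis by (rule that)
qed

end

section \<open>Zeros of polynomials modulo a prime\<close>

text \<open>This is the falling factorial, built by one factor \<open>X - j\<close> at a time; the
  factor \<open>fact j\<close> keeps the coefficients integral.\<close>

lemma fact_binomial_poly:
  "\<exists>B :: int poly. degree B \<le> j \<and> (\<forall>i. poly B (int i) = fact j * int (i choose j))"
proof (induction j)
  case 0
  show ?case by (intro exI[of _ 1]) simp
next
  case (Suc j)
  then obtain B :: "int poly" where B: "degree B \<le> j" "\<And>i. poly B (int i) = fact j * int (i choose j)"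
    by blast
  have "degree (B * [:- int j, 1:]) \<le> Suc j"
    by (rule order_trans[OF degree_mult_le]) (use B in simp)
  moreover have "poly (B * [:- int j, 1:]) (int i) = fact (Suc j) * int (i choose Suc j)" for i
  proof -
    have eq: "int (i choose j) * (int i - int j) = int (Suc j) * int (i choose Suc j)"
    proof (cases "j \<le> i")
      case True
      have "(i - j) * (i choose j) = Suc j * (i choose Suc j)"
        by (simp only: binomial_absorb_comp binomial_absorption)
      then have "int (i - j) * int (i choose j) = int (Suc j) * int (i choose Suc j)"
        by (metis of_nat_mult)
      then show ?thesis using True by (simp add: of_nat_diff mult.commute)
    qed (simp add: binomial_eq_0)
    have "poly (B * [:- int j, 1:]) (int i) = fact j * (int (i choose j) * (int i - int j))"
      by (simp add: B algebra_simps)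
    also have "\<dots> = fact (Suc j) * int (i choose Suc j)" unfolding eq by simp
    finally show ?thesis .
  qed
  ultimately show ?case by blast
qed

text \<open>Lagrange's bound on roots, carried out over the integers: synthetic division by
  \<open>X - r\<close> leaves the remainder \<open>poly Q r\<close>, which is divisible by
  \<open>p\<close>, and distinct points of \<open>{0..<p}\<close> are incongruent.\<close>

lemma poly_roots_mod_prime:
  fixes Q :: "int poly"
  assumes p: "prime p" and "degree Q < card R" "finite R" "R \<subseteq> {0..<p}"
    and "\<And>r. r \<in> R \<Longrightarrow> p dvd poly Q r"
  shows "p dvd poly Q x"
  using assms(2-)
proof (induction "degree Q" arbitrary: Q R)
  case 0
  then obtain r where "r \<in> R" by fastforce
  moreover obtain c where "Q = [:c:]" using 0 by (metis degree_eq_zeroE)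
  ultimately show ?case using 0 by fastforce
next
  case (Suc d)
  then obtain r where r: "r \<in> R" by fastforce
  define T where "T = synthetic_div Q r"
  have Q: "Q = [:- r, 1:] * T + [:poly Q r:]"
    unfolding T_def using synthetic_div_correct'[of r Q] by simp
  have eval: "poly Q s = (s - r) * poly T s + poly Q r" for s
    by (subst Q) (simp add: algebra_simps)
  have "p dvd poly T x"
  proof (rule Suc.hyps(1)[of T "R - {r}"])
    show "d = degree T" using Suc.hyps(2) by (simp add: T_def degree_synthetic_div)
    then show "degree T < card (R - {r})" using Suc.hyps(2) Suc.prems r by (simp add: card_Diff_singleton)
    fix s assume s: "s \<in> R - {r}"
    have "p dvd (s - r) * poly T s"
      using Suc.prems(4)[of s] Suc.prems(4)[OF r] s eval[of s] by (metis DiffD1 dvd_add_left_iff)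
    moreover have "\<not> p dvd s - r"
    proof
      assume dvd: "p dvd s - r"
      have "\<bar>s - r\<bar> < p" "s - r \<noteq> 0"
        using s r subsetD[OF Suc.prems(3), of s] subsetD[OF Suc.prems(3), of r] by auto
      with dvd show False using dvd_imp_le_int[of "s - r" p] by auto
    qed
    ultimately show "p dvd poly T s" using p prime_dvd_mult_iff by blast
  qed (use Suc.prems in auto)
  then show ?case using Suc.prems(4)[OF r] eval[of x] by simp
qed

text \<open>Multiplication by \<open>fact n\<close> turns the sum into an integer polynomial of
  degree at most \<open>n\<close>, and is invertible modulo \<open>p\<close> because
  \<open>n < p\<close>.\<close>

lemma binomial_sum_roots_mod_prime:
  fixes c :: "nat \<Rightarrow> int" and p :: nat
  assumes p: "prime p" and n: "n < p"
    and many: "n < card {i \<in> {..<p}. int p dvd (\<Sum>j<n. c j * int (i choose j))}"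
  shows "int p dvd (\<Sum>j<n. c j * int (i choose j))"
proof -
  obtain B :: "nat \<Rightarrow> int poly" where B: "\<And>j. degree (B j) \<le> j"
    "\<And>j i. poly (B j) (int i) = fact j * int (i choose j)"
    using fact_binomial_poly by metis
  define Q where "Q = (\<Sum>j<n. smult (c j * (fact n div fact j)) (B j))"
  have degQ: "degree Q \<le> n"
    unfolding Q_def
    by (rule degree_sum_le) (use B(1) in \<open>auto intro: order_trans[OF degree_smult_le] le_trans[OF _ less_imp_le]\<close>)
  have evalQ: "poly Q (int i) = fact n * (\<Sum>j<n. c j * int (i choose j))" for i
  proof -
    have "poly Q (int i) = (\<Sum>j<n. c j * ((fact n div fact j) * fact j) * int (i choose j))"
      by (simp add: Q_def poly_sum B(2) mult.assoc)
    also have "\<dots> = (\<Sum>j<n. c j * fact n * int (i choose j))"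
      by (intro sum.cong refl) (simp add: fact_dvd)
    finally show ?thesis by (simp add: sum_distrib_left mult_ac)
  qed
  let ?R = "{i \<in> {..<p}. int p dvd (\<Sum>j<n. c j * int (i choose j))}"
  have "int p dvd poly Q (int i)"
  proof (rule poly_roots_mod_prime[where R = "int ` ?R"])
    show "prime (int p)" using p by simp
    show "degree Q < card (int ` ?R)" using degQ many by (simp add: card_image)
  qed (auto simp: evalQ)
  moreover have "\<not> int p dvd fact n"
    using p n by (metis int_dvd_int_iff of_nat_fact prime_dvd_fact_iff not_le)
  ultimately show ?thesis
    unfolding evalQ using p by (metis prime_dvd_mult_iff prime_nat_int_transfer)
qed

section \<open>Counting zeros along cosets of cyclic subgroups\<close>

context group begin

text \<open>Newton's forward difference formula along the line \<open>g, g u, g u^2, ...\<close>, by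
  summing the expansion of the \<open>u\<close>-derivative.\<close>

lemma newton_expansion_mod:
  assumes "polynomial_mod G {k. (p::int) dvd k} n F" "g \<in> carrier G" "u \<in> carrier G"
  shows "\<exists>c. \<forall>i. p dvd F (g \<otimes> u [^] (i::nat)) - (\<Sum>j<n. c j * int (i choose j))"
  using assms(1)
proof (induction n arbitrary: F)
  case 0
  then show ?case using assms by auto
next
  case (Suc n)
  then have "polynomial_mod G {k. p dvd k} n (\<lambda>x. F (x \<otimes> u) - F x)" using assms(3) by simp
  from Suc.IH[OF this] obtain c where c: "\<And>i. p dvd (F (g \<otimes> u [^] (i::nat) \<otimes> u) - F (g \<otimes> u [^] i)) -
      (\<Sum>j<n. c j * int (i choose j))"
    by blast
  \<comment> \<open>Summation moves the coefficients of the derivative up by one index; the new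
    constant term is the value at the start of the line.\<close>
  define c' where "c' j = (case j of 0 \<Rightarrow> F g | Suc j \<Rightarrow> c j)" for j
  have sum: "(\<Sum>j<Suc n. c' j * int (i choose j)) = F g + (\<Sum>j<n. c j * int (i choose Suc j))" for i
    by (simp add: sum.lessThan_Suc_shift c'_def del: sum.lessThan_Suc)
  have "p dvd F (g \<otimes> u [^] (i::nat)) - (\<Sum>j<Suc n. c' j * int (i choose j))" for i
  proof (induction i)
    case 0
    then show ?case unfolding sum using assms by simp
  next
    case (Suc i)
    \<comment> \<open>Pascal's rule: the increment of the sum is the expansion of the
      derivative.\<close>
    have "(\<Sum>j<Suc n. c' j * int (Suc i choose j)) =
        (\<Sum>j<Suc n. c' j * int (i choose j)) + (\<Sum>j<n. c j * int (i choose j))"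
      unfolding sum by (simp add: sum.distrib algebra_simps)
    moreover have "g \<otimes> u [^] Suc i = g \<otimes> u [^] i \<otimes> u" using assms by (simp add: m_assoc)
    ultimately have eq: "F (g \<otimes> u [^] Suc i) - (\<Sum>j<Suc n. c' j * int (Suc i choose j)) =
        (F (g \<otimes> u [^] i \<otimes> u) - F (g \<otimes> u [^] i) - (\<Sum>j<n. c j * int (i choose j))) +
        (F (g \<otimes> u [^] i) - (\<Sum>j<Suc n. c' j * int (i choose j)))"
      by simp
    show ?case unfolding eq by (rule dvd_add[OF c Suc])
  qed
  then show ?case by blast
qed

text \<open>The Newton expansion reduces this to sums of binomial coefficients. The conclusion for
  \<open>i = 0\<close> and \<open>i = 1\<close> is what makes \<open>g\<close> a zero of the
  \<open>u\<close>-derivative.\<close>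

lemma line_zeros_mod_prime:
  fixes p :: nat
  assumes p: "prime p" "n < p" and F: "polynomial_mod G {k. int p dvd k} n F"
    and gu: "g \<in> carrier G" "u \<in> carrier G"
    and many: "n < card {i \<in> {..<p}. int p dvd F (g \<otimes> u [^] i)}"
  shows "int p dvd F (g \<otimes> u [^] (i::nat))"
proof -
  obtain c where c: "\<And>i. int p dvd F (g \<otimes> u [^] (i::nat)) - (\<Sum>j<n. c j * int (i choose j))"
    using newton_expansion_mod[OF F gu] by blast
  have iff: "int p dvd F (g \<otimes> u [^] (i::nat)) \<longleftrightarrow> int p dvd (\<Sum>j<n. c j * int (i choose j))" for i
    using c[of i] by (metis dvd_diff_commute dvd_diffD dvd_diff_right_iff)
  show ?thesis unfolding iff by (rule binomial_sum_roots_mod_prime[OF p many[unfolded iff]])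
qed

lemma card_preimage_bij_betw:
  assumes "bij_betw f A B" "V \<subseteq> B"
  shows "card {a \<in> A. f a \<in> V} = card V"
proof -
  have "f ` {a \<in> A. f a \<in> V} = V"
    using bij_betw_imp_surj_on[OF assms(1)] assms(2) by blast
  moreover have "inj_on f {a \<in> A. f a \<in> V}"
    using bij_betw_imp_inj_on[OF assms(1)] by (rule inj_on_subset) blast
  ultimately show ?thesis by (metis card_image)
qed

text \<open>Average over the lines \<open>g, gu, gu\<^sup>2, \<dots>\<close>: a line carries at most \<open>n\<close> zeros unless \<open>F\<close>
  vanishes on all of it, and then \<open>g\<close> is a zero of the \<open>u\<close>-derivative, whose zeros are counted
  by induction.\<close>
lemma zero_cosets_bound:
  fixes p :: nat
  assumes p: "prime p" and K: "K \<lhd> G" "finite (rcosets K)"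
    and period: "\<And>F x k. polynomial_mod G {k. int p dvd k} n F \<Longrightarrow> x \<in> carrier G \<Longrightarrow> k \<in> K
      \<Longrightarrow> int p dvd F (x \<otimes> k) - F x"
    and "n < p" "polynomial_mod G {k. int p dvd k} n F" "x \<in> carrier G" "\<not> int p dvd F x"
  shows "p * card ((\<lambda>g. K #> g) ` {g \<in> carrier G. int p dvd F g}) \<le> n\<^sup>2 * card (rcosets K)"
  using assms(4-)
proof (induction n arbitrary: F x)
  case 0
  then show ?case by simp
next
  case (Suc n)
  interpret K: normal K G by fact
  have sK: "subgroup K G" by (rule K.subgroup_axioms)
  let ?\<pi> = "(#>) K" and ?Q = "rcosets K"
  let ?V = "?\<pi> ` {g \<in> carrier G. int p dvd F g}"
  \<comment> \<open>The induction hypothesis asks for the period at bound \<open>n\<close>, and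
    \<open>polynomial_mod_Suc\<close> raises that bound to \<open>Suc n\<close>.\<close>
  have period': "int p dvd F' (x \<otimes> k) - F' x"
    if "polynomial_mod G {k. int p dvd k} n F'" "x \<in> carrier G" "k \<in> K" for F' x k
    using Suc.prems(1) polynomial_mod_Suc[OF additive_subset_multiples that(1)] that by blast
  \<comment> \<open>Divisibility of \<open>F g\<close> by \<open>p\<close> depends on the coset of
    \<open>g\<close> only. The period acts on the right, so right cosets are rewritten as left
    ones.\<close>
  have mem_V: "?\<pi> g \<in> ?V \<longleftrightarrow> int p dvd F g" if g: "g \<in> carrier G" for g
  proof
    assume "?\<pi> g \<in> ?V"
    then obtain h where h: "h \<in> carrier G" "int p dvd F h" "?\<pi> g = ?\<pi> h" by blast
    have "g \<in> ?\<pi> h" using rcos_self[OF g sK] h by simp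
    then have "g \<in> h <# K" using K.coset_eq h by blast
    then obtain k where "k \<in> K" "g = h \<otimes> k" by (auto simp: l_coset_def)
    then have "int p dvd F g - F h" using Suc.prems h by blast
    from dvd_add[OF this h(2)] show "int p dvd F g" by simp
  qed (use g in blast)
  show ?case
  proof (cases "\<exists>u\<in>carrier G. \<exists>y\<in>carrier G. \<not> int p dvd F (y \<otimes> u) - F y")
    case False
    \<comment> \<open>Here \<open>F\<close> is constant modulo \<open>p\<close>, and its value at
      \<open>x\<close> is nonzero.\<close>
    have "\<not> int p dvd F g" if g: "g \<in> carrier G" for g
    proof -
      have "int p dvd F (x \<otimes> (inv x \<otimes> g)) - F x" using False g Suc.prems by blast
      moreover have "x \<otimes> (inv x \<otimes> g) = g" using g Suc.prems inv_mult_cancel by simp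
      ultimately have "int p dvd F g - F x" by simp
      with Suc.prems(5) dvd_diff[of "int p" "F g" "F g - F x"] show ?thesis by auto
    qed
    then have empty: "{g \<in> carrier G. int p dvd F g} = {}" by blast
    show ?thesis unfolding empty by simp
  next
    case True
    then obtain u y where u: "u \<in> carrier G" and y: "y \<in> carrier G" "\<not> int p dvd F (y \<otimes> u) - F y"
      by blast
    let ?W = "?\<pi> ` {g \<in> carrier G. int p dvd F (g \<otimes> u) - F g}"
    \<comment> \<open>The \<open>u\<close>-derivative is nonzero modulo \<open>p\<close> at
      \<open>y\<close>, as the induction hypothesis requires.\<close>
    have IH: "p * card ?W \<le> n\<^sup>2 * card ?Q"
      by (rule Suc.IH[where x = y]) (use period' Suc.prems u y in auto)
    \<comment> \<open>Right translation by \<open>u^i\<close> permutes the cosets, so each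
      \<open>i\<close> meets \<open>?V\<close> equally often.\<close>
    define \<tau> where "\<tau> i q = q #> u [^] i" for i :: nat and q
    have \<tau>: "\<tau> i (?\<pi> g) = ?\<pi> (g \<otimes> u [^] i)" if "g \<in> carrier G" for g i
      using that u K.subset by (simp add: \<tau>_def coset_mult_assoc)
    have bij: "bij_betw (\<tau> i) ?Q ?Q" for i
    proof (rule bij_betw_byWitness[where f' = "\<lambda>q. q #> inv (u [^] i)"])
      have cancel: "?\<pi> g #> u [^] i #> inv (u [^] i) = ?\<pi> g" "?\<pi> g #> inv (u [^] i) #> u [^] i = ?\<pi> g"
        "?\<pi> g #> u [^] i \<in> ?Q" "?\<pi> g #> inv (u [^] i) \<in> ?Q" if "g \<in> carrier G" for g
        using that u K.subset by (simp_all add: coset_mult_assoc m_assoc rcosetsI)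
      show "\<forall>q\<in>?Q. \<tau> i q #> inv (u [^] i) = q" "\<forall>q\<in>?Q. \<tau> i (q #> inv (u [^] i)) = q"
        "\<tau> i ` ?Q \<subseteq> ?Q" "(\<lambda>q. q #> inv (u [^] i)) ` ?Q \<subseteq> ?Q"
        using cancel by (auto simp: \<tau>_def RCOSETS_def)
    qed
    have VQ: "?V \<subseteq> ?Q" and WQ: "?W \<subseteq> ?Q" using K.subset by (auto intro: rcosetsI)
    have shifted: "card {q \<in> ?Q. \<tau> i q \<in> ?V} = card ?V" for i
      by (rule card_preimage_bij_betw[OF bij VQ])
    have fiber: "card {i \<in> {..<p}. \<tau> i q \<in> ?V} \<le> Suc n + (if q \<in> ?W then p else 0)" if q: "q \<in> ?Q" for q
    proof -
      obtain g where g: "g \<in> carrier G" "q = ?\<pi> g" using q by (auto simp: RCOSETS_def)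
      have eq: "{i \<in> {..<p}. \<tau> i q \<in> ?V} = {i \<in> {..<p}. int p dvd F (g \<otimes> u [^] i)}"
        using g u \<tau> mem_V by simp
      have "card {i \<in> {..<p}. \<tau> i q \<in> ?V} \<le> card {..<p}" by (intro card_mono) auto
      then have le: "card {i \<in> {..<p}. \<tau> i q \<in> ?V} \<le> p" by simp
      show ?thesis
      proof (cases "Suc n < card {i \<in> {..<p}. \<tau> i q \<in> ?V}")
        case many: True
        have zero: "int p dvd F (g \<otimes> u [^] i)" for i :: nat
          using line_zeros_mod_prime[OF p Suc.prems(2,3) g(1) u] many unfolding eq by blast
        have "int p dvd F (g \<otimes> u) - F g" using zero[of 0] zero[of 1] g u by simp
        then have "q \<in> ?W" using g by blast
        then show ?thesis using le by simp
      qed simp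
    qed
    \<comment> \<open>Double counting of the pairs \<open>(i, q)\<close> with
      \<open>\<tau> i q\<close> in \<open>?V\<close>, first by \<open>i\<close>, then by
      \<open>q\<close>.\<close>
    have "p * card ?V = (\<Sum>i<p. card {q \<in> ?Q. \<tau> i q \<in> ?V})" using shifted by simp
    also have "\<dots> = (\<Sum>i<p. \<Sum>q\<in>?Q. of_bool (\<tau> i q \<in> ?V))"
      using K(2) by (simp add: Int_def)
    also have "\<dots> = (\<Sum>q\<in>?Q. \<Sum>i<p. of_bool (\<tau> i q \<in> ?V))" by (rule sum.swap)
    also have "\<dots> = (\<Sum>q\<in>?Q. card {i \<in> {..<p}. \<tau> i q \<in> ?V})" by (simp add: Int_def)
    also have "\<dots> \<le> (\<Sum>q\<in>?Q. Suc n + (if q \<in> ?W then p else 0))" by (intro sum_mono fiber)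
    also have "\<dots> = Suc n * card ?Q + p * card ?W"
      by (simp only: sum.distrib sum.If_cases[OF K(2)] Collect_mem_eq Int_absorb1[OF WQ]) simp
    also have "\<dots> \<le> Suc n * card ?Q + n\<^sup>2 * card ?Q" using IH by simp
    also have "\<dots> \<le> (Suc n)\<^sup>2 * card ?Q"
      by (simp add: power2_eq_square algebra_simps)
    finally show ?thesis .
  qed
qed

end

section \<open>From nilpotent-valued to integer-valued polynomials, and the conclusion\<close>

lemma (in group) polynomial_mod_hom_comp:
  fixes f :: "'c \<Rightarrow> 'r::ab_group_add"
  assumes H: "group H" and M: "subgroup M H"
    and f: "\<And>a b. a \<in> M \<Longrightarrow> b \<in> M \<Longrightarrow> f (a \<otimes>\<^bsub>H\<^esub> b) = f a + f b"
    and "\<And>x. x \<in> carrier G \<Longrightarrow> \<psi> x \<in> M"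
    and "\<And>us x. set us \<subseteq> carrier G \<Longrightarrow> length us = n \<Longrightarrow> x \<in> carrier G \<Longrightarrow>
      foldr (group_derivative G H) us \<psi> x = \<one>\<^bsub>H\<^esub>"
  shows "polynomial_mod G {0} n (\<lambda>x. f (\<psi> x))"
  using assms(4,5)
proof (induction n arbitrary: \<psi>)
  case 0
  have "f \<one>\<^bsub>H\<^esub> = 0"
    using f[of "\<one>\<^bsub>H\<^esub>" "\<one>\<^bsub>H\<^esub>"] subgroup.one_closed[OF M] group.is_monoid[OF H] by (simp add: monoid.l_one monoid.one_closed)
  then show ?case using 0(2)[of "[]"] by simp
next
  case (Suc n)
  interpret H: group H by fact
  interpret M: subgroup M H by fact
  show ?case
    unfolding polynomial_mod.simps
  proof
    fix u assume u: "u \<in> carrier G"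
    let ?d = "group_derivative G H u \<psi>"
    have "polynomial_mod G {0} n (\<lambda>x. f (?d x))"
    proof (rule Suc.IH)
      show "?d x \<in> M" if "x \<in> carrier G" for x
        using Suc.prems(1) u that by (simp add: group_derivative_def)
      \<comment> \<open>The last entry of the list is the derivative taken first, so
        \<open>u\<close> is appended at the end.\<close>
      show "foldr (group_derivative G H) us ?d x = \<one>\<^bsub>H\<^esub>"
        if "set us \<subseteq> carrier G" "length us = n" "x \<in> carrier G" for us x
        using Suc.prems(2)[of "us @ [u]" x] that u by simp
    qed
    then show "polynomial_mod G {0} n (\<lambda>x. f (\<psi> (x \<otimes> u)) - f (\<psi> x))"
    proof (rule polynomial_mod_carrier_cong)
      fix x assume x: "x \<in> carrier G"
      have \<psi>: "\<psi> x \<in> M" "\<psi> (x \<otimes> u) \<in> M" using Suc.prems(1) x u by auto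
      \<comment> \<open>The homomorphism turns the group derivative into a difference; both factors
        must lie in \<open>M\<close>, where \<open>f\<close> is additive.\<close>
      then have "f (\<psi> x) + f (?d x) = f (\<psi> (x \<otimes> u))"
        using f[of "\<psi> x" "?d x"] by (simp add: group_derivative_def H.inv_mult_cancel)
      then show "f (?d x) = f (\<psi> (x \<otimes> u)) - f (\<psi> x)" by (simp add: algebra_simps)
    qed
  qed
qed

lemma polynomial_mod_of_int:
  assumes "polynomial_mod G {0} n (\<lambda>x. real_of_int (F x))"
  shows "polynomial_mod G {0} n F"
  using assms
proof (induction n arbitrary: F)
  case (Suc n)
  then show ?case using Suc.IH[of "\<lambda>x. F (x \<otimes>\<^bsub>G\<^esub> u) - F x" for u] by simp
qed simp

lemma (in group) negligible_zeros:
  fixes F :: "'a \<Rightarrow> int"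
  assumes S: "finite S" "S \<subseteq> carrier G" "generate G S = carrier G"
    and F: "polynomial_mod G {0} n F" and x: "x \<in> carrier G" "F x \<noteq> 0"
    and V: "V \<subseteq> carrier G" "\<And>g. g \<in> V \<Longrightarrow> F g = 0"
  shows "negligible_by_finite_quotients G V"
  unfolding negligible_by_finite_quotients_def
proof (intro conjI allI impI)
  fix \<epsilon> :: real assume eps: "\<epsilon> > 0"
  \<comment> \<open>The three bounds serve the root count on lines, the nonvanishing of
    \<open>F x\<close> modulo \<open>p\<close>, and the density estimate
    \<open>n^2 / p \<le> \<epsilon>\<close>.\<close>
  obtain p where p: "prime p" and "p > max (max n (nat \<bar>F x\<bar>)) (nat \<lceil>real (n\<^sup>2) / \<epsilon>\<rceil>)"
    using bigger_prime by blast
  then have p_gt: "n < p" "nat \<bar>F x\<bar> < p" "nat \<lceil>real (n\<^sup>2) / \<epsilon>\<rceil> < p" by simp_all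
  have p0: "int p > 0" using p_gt(1) by simp
  obtain K where K: "K \<lhd> G" "finite (rcosets K)"
    and period: "\<And>F x k. polynomial_mod G {k. int p dvd k} n F \<Longrightarrow> x \<in> carrier G \<Longrightarrow> k \<in> K \<Longrightarrow>
      int p dvd F (x \<otimes> k) - F x"
    by (rule exists_common_period[OF S p0, where n = n]) (rule that)
  have "\<not> int p dvd F x"
  proof
    assume "int p dvd F x"
    then have "int p \<le> \<bar>F x\<bar>" using dvd_imp_le_int[OF x(2), of "int p"] by simp
    then show False using p_gt(2) by linarith
  qed
  moreover have "polynomial_mod G {k. int p dvd k} n F"
    by (rule polynomial_mod_mono[OF _ F]) auto
  ultimately have bound: "p * card ((#>) K ` {g \<in> carrier G. int p dvd F g}) \<le> n\<^sup>2 * card (rcosets K)"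
    using zero_cosets_bound[OF p K period p_gt(1) _ x(1)] by blast
  have "(#>) K ` V \<subseteq> (#>) K ` {g \<in> carrier G. int p dvd F g}" using V by auto
  moreover have "(#>) K ` {g \<in> carrier G. int p dvd F g} \<subseteq> rcosets K"
    by (auto simp: RCOSETS_def)
  ultimately have "card ((#>) K ` V) \<le> card ((#>) K ` {g \<in> carrier G. int p dvd F g})"
    using K(2) by (meson card_mono finite_subset)
  then have "p * card ((#>) K ` V) \<le> n\<^sup>2 * card (rcosets K)"
    using bound by (meson le_trans mult_le_mono2)
  then have le: "real p * real (card ((#>) K ` V)) \<le> real (n\<^sup>2) * real (card (rcosets K))"
    by (metis of_nat_le_iff of_nat_mult)
  have "real (n\<^sup>2) / \<epsilon> \<le> real p"
    using real_nat_ceiling_ge[of "real (n\<^sup>2) / \<epsilon>"] p_gt(3) by linarith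
  then have "real (n\<^sup>2) \<le> \<epsilon> * real p" using eps by (simp add: field_simps)
  then have "real (n\<^sup>2) * real (card (rcosets K)) \<le> real p * (\<epsilon> * real (card (rcosets K)))"
    using mult_right_mono[of "real (n\<^sup>2)" "\<epsilon> * real p" "real (card (rcosets K))"] by (simp add: mult_ac)
  with le have "real p * real (card ((#>) K ` V)) \<le> real p * (\<epsilon> * real (card (rcosets K)))" by linarith
  then have "real (card ((#>) K ` V)) \<le> \<epsilon> * real (card (rcosets K))"
    using p0 by simp
  then show "\<exists>K. K \<lhd> G \<and> finite (carrier (G Mod K)) \<and>
      real (card ((\<lambda>g. K #> g) ` V)) \<le> \<epsilon> * real (card (carrier (G Mod K)))"
    using K by (intro exI[of _ K]) (simp add: FactGroup_def)
qed (fact V)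

theorem theorem5p1:
  fixes G :: "('a, 'b) monoid_scheme"
    and N :: "('c, 'd) monoid_scheme"
    and \<Gamma> :: "'c set"
    and \<phi> :: "'a \<Rightarrow> 'c"
    and x :: 'c
  assumes "finitely_generated_group G"
    and "nilpotent_group N"
    and "closed_subgroup \<Gamma> N"
    and "polynomial_map G N \<phi>"
    and "x \<in> carrier N"
    and "\<not> \<phi> ` carrier G \<subseteq> x <#\<^bsub>N\<^esub> \<Gamma>"
  shows "negligible_by_finite_quotients G {g \<in> carrier G. \<phi> g \<in> x <#\<^bsub>N\<^esub> \<Gamma>}"
proof -
  obtain S where S: "finite S" "S \<subseteq> carrier G" "generate G S = carrier G" and "group G"
    using assms(1) by (auto simp: finitely_generated_group_def)
  interpret G: group G by fact
  interpret N: group N using assms(2) by (simp add: nilpotent_group_def)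
  have \<Gamma>: "subgroup \<Gamma> N"
    and root: "\<And>y k. y \<in> carrier N \<Longrightarrow> k > 0 \<Longrightarrow> y [^]\<^bsub>N\<^esub> (k::nat) \<in> \<Gamma> \<Longrightarrow> y \<in> \<Gamma>"
    using assms(3) unfolding closed_subgroup_def
    by (simp, metis int_pow_int of_nat_0_less_iff less_irrefl)
  obtain d where "polynomial_of_degree G N d \<phi>" using assms(4) by (auto simp: polynomial_map_def)
  then have \<phi>: "\<phi> \<in> carrier G \<rightarrow> carrier N"
    and deg: "\<And>us g. set us \<subseteq> carrier G \<Longrightarrow> length us = Suc d \<Longrightarrow> g \<in> carrier G \<Longrightarrow>
      foldr (group_derivative G N) us \<phi> g = \<one>\<^bsub>N\<^esub>"
    by (simp_all add: polynomial_of_degree_def)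
  define \<psi> where "\<psi> g = inv\<^bsub>N\<^esub> x \<otimes>\<^bsub>N\<^esub> \<phi> g" for g
  have \<psi>: "\<psi> g \<in> carrier N" if "g \<in> carrier G" for g using \<phi> that assms(5) by (auto simp: \<psi>_def)
  have coset_iff: "\<phi> g \<in> x <#\<^bsub>N\<^esub> \<Gamma> \<longleftrightarrow> \<psi> g \<in> \<Gamma>" if g: "g \<in> carrier G" for g
  proof
    assume "\<phi> g \<in> x <#\<^bsub>N\<^esub> \<Gamma>"
    then show "\<psi> g \<in> \<Gamma>" using assms(5) subgroup.mem_carrier[OF \<Gamma>]
      by (auto simp: l_coset_def \<psi>_def N.inv_mult_cancel)
  next
    assume "\<psi> g \<in> \<Gamma>"
    moreover have "\<phi> g \<in> carrier N" using \<phi> g by auto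
    then have "\<phi> g = x \<otimes>\<^bsub>N\<^esub> \<psi> g"
      using assms(5) by (simp add: \<psi>_def N.inv_mult_cancel)
    ultimately show "\<phi> g \<in> x <#\<^bsub>N\<^esub> \<Gamma>" by (auto simp: l_coset_def)
  qed
  \<comment> \<open>Since the values of \<open>\<psi>\<close> generate \<open>M\<close>, a nonzero
    homomorphism on \<open>M\<close> cannot vanish on all of them.\<close>
  define M where "M = generate N (\<psi> ` carrier G)"
  have M: "subgroup M N" unfolding M_def using \<psi> by (intro N.generate_is_subgroup) blast
  have \<psi>M: "\<psi> g \<in> M" if "g \<in> carrier G" for g
    unfolding M_def using that by (blast intro: generate.incl)
  let ?M = "N\<lparr>carrier := M\<rparr>"
  interpret M: group ?M using M by (rule N.subgroup_imp_group)
  have sub: "subgroup (\<Gamma> \<inter> M) ?M"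
    using N.subgroup_incl[OF N.subgroups_Inter_pair[OF \<Gamma> M] M] by simp
  obtain g0 where g0: "g0 \<in> carrier G" "\<psi> g0 \<notin> \<Gamma>" using assms(6) coset_iff by blast
  \<comment> \<open>As \<open>\<Gamma>\<close> is closed, no positive power of an element outside
    \<open>\<Gamma>\<close> falls into it.\<close>
  have "\<psi> g0 [^]\<^bsub>?M\<^esub> k \<notin> \<Gamma> \<inter> M" if "k > 0" for k :: nat
    using root[OF \<psi>[OF g0(1)] that] g0(2) by (auto simp: N.nat_pow_consistent[symmetric])
  then have "\<exists>f :: 'c \<Rightarrow> real. (\<exists>a\<in>M. f a \<noteq> 0) \<and> (\<forall>a\<in>\<Gamma> \<inter> M. f a = 0) \<and> (\<forall>a\<in>M. f a \<in> \<rat>) \<and>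
      (\<forall>a\<in>M. \<forall>b\<in>M. f (a \<otimes>\<^bsub>N\<^esub> b) = f a + f b)"
    using M.exists_real_hom_vanishing[OF N.nilpotent_subgroup[OF assms(2) M] sub, of "\<psi> g0"]
      \<psi>M[OF g0(1)] by simp
  then obtain f :: "'c \<Rightarrow> real" where f0: "\<exists>a\<in>M. f a \<noteq> 0" "\<forall>a\<in>\<Gamma> \<inter> M. f a = 0"
    "\<forall>a\<in>M. f a \<in> \<rat>" "\<forall>a\<in>M. \<forall>b\<in>M. f (a \<otimes>\<^bsub>N\<^esub> b) = f a + f b"
    by blast
  then have f: "\<exists>a\<in>M. f a \<noteq> 0" "\<And>a. a \<in> \<Gamma> \<Longrightarrow> a \<in> M \<Longrightarrow> f a = 0"
    "\<And>a. a \<in> M \<Longrightarrow> f a \<in> \<rat>" "\<And>a b. a \<in> M \<Longrightarrow> b \<in> M \<Longrightarrow> f (a \<otimes>\<^bsub>N\<^esub> b) = f a + f b"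
    by simp_all
  have f1: "f \<one>\<^bsub>N\<^esub> = 0" using f(2) \<Gamma> M subgroup.one_closed by blast
  have "\<exists>g1\<in>carrier G. f (\<psi> g1) \<noteq> 0"
  proof (rule ccontr)
    assume "\<not> ?thesis"
    then have zero: "f (\<psi> g) = 0" if "g \<in> carrier G" for g using that by blast
    have "f a = 0" if "a \<in> M" for a
      using that[unfolded M_def]
    proof induction
      case (inv h)
      then obtain g where g: "g \<in> carrier G" "h = \<psi> g" by blast
      then have "f (h \<otimes>\<^bsub>N\<^esub> inv\<^bsub>N\<^esub> h) = f h + f (inv\<^bsub>N\<^esub> h)"
        using f(4) \<psi>M subgroup.m_inv_closed[OF M] by blast
      then show ?case using zero g \<psi> f1 by simp
    next
      case (eng h1 h2)
      then show ?case using f(4) by (simp add: M_def)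
    qed (use f1 zero in auto)
    then show False using f(1) by blast
  qed
  then obtain g1 where g1: "g1 \<in> carrier G" "f (\<psi> g1) \<noteq> 0" by blast
  \<comment> \<open>\<open>\<psi>\<close> and \<open>\<phi>\<close> have the same derivatives, since
    the factor \<open>inv x\<close> cancels. The degree bound for \<open>\<phi>\<close> can
    therefore be used without translating it to \<open>\<psi>\<close>.\<close>
  have deriv: "\<psi> g \<otimes>\<^bsub>N\<^esub> group_derivative G N u \<phi> g = \<psi> (g \<otimes>\<^bsub>G\<^esub> u)"
    "group_derivative G N u \<phi> g \<in> M" if "u \<in> carrier G" "g \<in> carrier G" for u g
  proof -
    have car: "\<phi> g \<in> carrier N" "\<phi> (g \<otimes>\<^bsub>G\<^esub> u) \<in> carrier N" using \<phi> that by auto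
    then show "\<psi> g \<otimes>\<^bsub>N\<^esub> group_derivative G N u \<phi> g = \<psi> (g \<otimes>\<^bsub>G\<^esub> u)"
      using assms(5) by (simp add: \<psi>_def group_derivative_def N.m_assoc N.inv_mult_cancel)
    have "group_derivative G N u \<phi> g = inv\<^bsub>N\<^esub> (\<psi> g) \<otimes>\<^bsub>N\<^esub> \<psi> (g \<otimes>\<^bsub>G\<^esub> u)"
      using car assms(5)
      by (simp add: \<psi>_def group_derivative_def N.m_assoc N.inv_mult_cancel N.inv_mult_group)
    then show "group_derivative G N u \<phi> g \<in> M"
      using \<psi>M that M by (simp add: subgroup.m_closed subgroup.m_inv_closed)
  qed
  \<comment> \<open>The factor \<open>c\<close> lets one fact serve both \<open>c = 1\<close>, for
    bounding denominators, and \<open>c = D\<close>, for the integer-valued function.\<close>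
  have poly: "polynomial_mod G {0} (Suc d) (\<lambda>g. c * f (\<psi> g))" for c
    unfolding polynomial_mod.simps
  proof
    fix u assume u: "u \<in> carrier G"
    have "polynomial_mod G {0} d (\<lambda>g. c * f (group_derivative G N u \<phi> g))"
    proof (rule G.polynomial_mod_hom_comp[OF N.is_group M])
      show "c * f (a \<otimes>\<^bsub>N\<^esub> b) = c * f a + c * f b" if "a \<in> M" "b \<in> M" for a b
        using f(4)[OF that] by (simp add: distrib_left)
      show "foldr (group_derivative G N) us (group_derivative G N u \<phi>) g = \<one>\<^bsub>N\<^esub>"
        if "set us \<subseteq> carrier G" "length us = d" "g \<in> carrier G" for us g
        using deg[of "us @ [u]" g] that u by simp
    qed (use deriv u in blast)
    then show "polynomial_mod G {0} d (\<lambda>g. c * f (\<psi> (g \<otimes>\<^bsub>G\<^esub> u)) - c * f (\<psi> g))"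
    proof (rule G.polynomial_mod_carrier_cong)
      fix g assume g: "g \<in> carrier G"
      show "c * f (group_derivative G N u \<phi> g) = c * f (\<psi> (g \<otimes>\<^bsub>G\<^esub> u)) - c * f (\<psi> g)"
        using f(4)[OF \<psi>M[OF g] deriv(2)[OF u g]] deriv(1)[OF u g] by (simp add: algebra_simps)
    qed
  qed
  obtain D :: int where D: "D > 0" "\<And>g. g \<in> carrier G \<Longrightarrow> of_int D * f (\<psi> g) \<in> \<int>"
    using G.bounded_denominators[OF S poly[of 1]] f(3) \<psi>M by auto
  \<comment> \<open>On the carrier the argument is already an integer; the floor just moves it to
    type \<open>int\<close>.\<close>
  define F where "F g = \<lfloor>of_int D * f (\<psi> g)\<rfloor>" for g
  have F: "of_int (F g) = of_int D * f (\<psi> g)" if "g \<in> carrier G" for g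
    using D(2)[OF that] by (simp add: F_def)
  show ?thesis
  proof (rule G.negligible_zeros[OF S])
    show "polynomial_mod G {0} (Suc d) F"
      by (rule polynomial_mod_of_int, rule G.polynomial_mod_carrier_cong[OF poly[of "of_int D"]])
        (simp add: F)
    show "g1 \<in> carrier G" "F g1 \<noteq> 0" using F[of g1] g1 D by auto
    show "F g = 0" if "g \<in> {g \<in> carrier G. \<phi> g \<in> x <#\<^bsub>N\<^esub> \<Gamma>}" for g
      using that f(2)[of "\<psi> g"] \<psi>M[of g] coset_iff[of g] by (simp add: F_def)
  qed blast
qed

end
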